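(* Let $B^H=\{B^H(t),t\in\mathbb{R}_+^N\}$ be an $(N,d)$-fractional Brownian sheet with index $H=(H_1,\ldots,H_N)\in(0,1)^N$, where $H_1\le\cdots\le H_N$, and let $I\in\mathcal{A}$ be a fixed interval. Then there exists a constant $c>0$ such that for every $s\in I$, $$\liminf_{r\to0}\sup_{t\in U(s,r)}\frac{|B^H(t)-B^H(s)|}{r^{H_1}(\log\log r^{-1})^{-H_1}}\ge c\quad\text{a.s.}$$ and $$\liminf_{r\to0}\inf_{s\in I}\sup_{t\in U(s,r)}\frac{|B^H(t)-B^H(s)|}{r^{H_1}(\log r^{-1})^{-H_1}}\ge c\quad\text{a.s.}$$ In particular, the sample function $B^H(t)$ is almost surely nowhere differentiable in $(0,\infty)^N$.
   Context: Write $\mathbb{R}_+^N=[0,\infty)^N$. For $s,t\in\mathbb{R}^N$ with $s_j<t_j$ for all $j$, $[s,t]=\prod_{j=1}^N[s_j,t_j]$; $\mathcal{A}$ denotes the class of all such closed intervals contained in $(0,\infty)^N$. $|\cdot|$ is the Euclidean norm and $U(s,r)$ is the open Euclidean ball in $\mathbb{R}^N$ centered at $s$ with radius $r$. A real-valued fractional Brownian sheet $B_0^H$ with index $H\in(0,1)^N$ is a centered Gaussian random field on $\mathbb{R}_+^N$ with covariance $$\mathbb{E}[B_0^H(s)B_0^H(t)]=\prod_{\ell=1}^N\frac12\left(s_\ell^{2H_\ell}+t_\ell^{2H_\ell}-|s_\ell-t_\ell|^{2H_\ell}\right).$$ An $(N,d)$-fractional Brownian sheet with index $H$ is the $\mathbb{R}^d$-valued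 field $B^H(t)=(B_1^H(t),\ldots,B_d^H(t))$, where $B_1^H,\ldots,B_d^H$ are independent copies of $B_0^H$; it is taken with continuous sample paths. *)

theory Defs
  imports "HOL-Probability.Probability"
begin

definition nonneg_orthant :: "(real^'n) set" where
  "nonneg_orthant = {t. \<forall>j. 0 \<le> t $ j}"

definition pos_orthant :: "(real^'n) set" where
  "pos_orthant = {t. \<forall>j. 0 < t $ j}"

definition pos_intervals :: "(real^'n) set set" where
  "pos_intervals = {cbox a b | a b. (\<forall>j. a $ j < b $ j) \<and> cbox a b \<subseteq> pos_orthant}"

text \<open>Degenerate (almost surely constant) laws count as Gaussian: a fractional Brownian sheet
  vanishes almost surely wherever some coordinate is zero.\<close>

definition gaussian_rv :: "'w measure \<Rightarrow> ('w \<Rightarrow> real) \<Rightarrow> bool" where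
  "gaussian_rv M Y \<longleftrightarrow> Y \<in> borel_measurable M \<and>
     ((\<exists>\<mu> \<sigma>. 0 < \<sigma> \<and> distributed M lborel Y (normal_density \<mu> \<sigma>)) \<or> (\<exists>\<mu>. AE \<omega> in M. Y \<omega> = \<mu>))"

definition gaussian_field :: "'w measure \<Rightarrow> 't set \<Rightarrow> ('t \<Rightarrow> 'w \<Rightarrow> real) \<Rightarrow> bool" where
  "gaussian_field M T X \<longleftrightarrow>
     (\<forall>F a. finite F \<longrightarrow> F \<subseteq> T \<longrightarrow> gaussian_rv M (\<lambda>\<omega>. \<Sum>t\<in>F. a t * X t \<omega>))"

definition fbs_cov :: "real^'n \<Rightarrow> real^'n \<Rightarrow> real^'n \<Rightarrow> real" where
  "fbs_cov H s t = (\<Prod>l\<in>UNIV. 1 / 2 *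
     ((s $ l) powr (2 * H $ l) + (t $ l) powr (2 * H $ l) - \<bar>s $ l - t $ l\<bar> powr (2 * H $ l)))"

definition real_fbs :: "'w measure \<Rightarrow> real^'n \<Rightarrow> (real^'n \<Rightarrow> 'w \<Rightarrow> real) \<Rightarrow> bool" where
  "real_fbs M H X \<longleftrightarrow>
     gaussian_field M nonneg_orthant X \<and>
     (\<forall>t\<in>nonneg_orthant. (LINT \<omega>|M. X t \<omega>) = 0) \<and>
     (\<forall>s\<in>nonneg_orthant. \<forall>t\<in>nonneg_orthant. (LINT \<omega>|M. X s \<omega> * X t \<omega>) = fbs_cov H s t)"

text \<open>The parameter set is the closed nonnegative orthant; the values of \<open>B\<close> at other
  points are unconstrained. Independence is that of the component processes, viewed as random
  elements of the product space over the orthant.\<close>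

definition fractional_brownian_sheet ::
    "'w measure \<Rightarrow> real^'n \<Rightarrow> (real^'n \<Rightarrow> 'w \<Rightarrow> real^'d) \<Rightarrow> bool" where
  "fractional_brownian_sheet M H B \<longleftrightarrow>
     (\<forall>i. real_fbs M H (\<lambda>t \<omega>. B t \<omega> $ i)) \<and>
     prob_space.indep_vars M (\<lambda>i. Pi\<^sub>M nonneg_orthant (\<lambda>t. borel))
       (\<lambda>i \<omega>. \<lambda>t\<in>nonneg_orthant. B t \<omega> $ i) UNIV \<and>
     (\<forall>\<omega>\<in>space M. continuous_on nonneg_orthant (\<lambda>t. B t \<omega>))"

end

theory Submission
  imports Defs "HOL-Real_Asymp.Real_Asymp"
begin

text \<open>Only one component of the field and one coordinate direction, that of the smallest index, are
  needed. Along this direction the sheet is, up to a factor bounded away from zero on the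
  interval, a fractional Brownian motion, so its increments from a base point, sampled at
  equally spaced points, have the covariance of a rescaled fractional Brownian motion at
  the positive integers. The spectral representation
  of $|t|^{2H}$, restricted to frequencies in $(0,\pi)$, and orthogonality of the trigonometric system
  bound the covariance matrix of the sampled increments below by a multiple of the identity,
  uniformly in their number. Inserting $e^{-y^2/2} = \mathbb{E}\, e^{i g y}$ for a standard
  normal $g$ turns this into a small ball estimate that is exponential in the number of
  sampled points. The two limits follow from the Borel--Cantelli lemma along $r = e^{-n}$, the second
  one after a union bound over a net of the interval.\<close>

section \<open>Spectral bound for the covariance of fractional Brownian motion\<close>

text \<open>With \<open>m\<close> equally spaced points in a ball of radius of order r, the typical
  sampled increment has order (r/m)^\<open>H1\<close>, and the probability that all of them are much
  smaller decays like exp(-m/2). This trade fixes both gauges: along r = e^(-n), summability over n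
  needs m of order log n, about log log(1/r), whereas a union bound over about e^(nN) net points
  needs m of order n, about log(1/r). The sampled increments are dependent; the lower bound on their
  covariance, uniform in m, takes the place of independence. The second limit involves uncountably
  many base points, yet no modulus of continuity is used: a net point s' near s and the sampled
  point t at which the increment from s' is large both lie in the ball around s, so the increment
  from s to t or from s to s' is at least half as large. The suprema over balls are never treated as
  random variables; only events about finitely many values of the field enter.\<close>

definition fbm_spectral :: "real \<Rightarrow> real \<Rightarrow> real \<Rightarrow> real" where
  "fbm_spectral a t u = indicator {0<..} u * ((1 - cos (t * u)) * u powr (-1 - a))"

text \<open>The constant of the spectral representation: for 0 < a < 2, the integral of (1 -
  cos(tu)) u^(-1-a) over u > 0 is |t|^a times it.\<close>

definition fbm_const :: "real \<Rightarrow> real" where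
  "fbm_const a = (LINT u|lborel. fbm_spectral a 1 u)"

lemma fbm_spectral_measurable [measurable]: "fbm_spectral a t \<in> borel_measurable borel"
  unfolding fbm_spectral_def by measurable

text \<open>Both bounds on \<open>a\<close> enter: near 0 the estimate 1 - cos u \<le> u^2 leaves
  u^(1-a), integrable because a < 2, and beyond 1 the bound 2 u^(-1-a) is integrable because a >
  0.\<close>

lemma integrable_fbm_spectral_1:
  assumes "0 < a" "a < 2"
  shows "integrable lborel (fbm_spectral a 1)"
proof -
  \<comment> \<open>The power integrals are known as gauge integrals; nonnegativity makes them
    absolutely integrable for Lebesgue measure, and Borel measurability brings them down to
    \<open>lborel\<close>.\<close>
  have set_integrable_powr: "set_integrable lborel A (\<lambda>u::real. u powr b)"
    if "(\<lambda>u. u powr b) integrable_on A" "A \<in> sets borel" for A b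
  proof -
    have "integrable lebesgue (\<lambda>u. indicator A u *\<^sub>R u powr b)"
      using nonnegative_absolutely_integrable_1[OF that(1)] by (simp add: set_integrable_def)
    moreover have "(\<lambda>u. indicator A u *\<^sub>R u powr b) \<in> borel_measurable lborel"
      using that(2) by measurable
    ultimately show ?thesis
      by (simp add: set_integrable_def integrable_completion)
  qed
  have 1: "set_integrable lborel {0..1} (\<lambda>u::real. u powr (1 - a))"
    using has_integral_powr_from_0[of "1 - a" 1] assms
    by (intro set_integrable_powr) (auto simp: integrable_on_def)
  have 2: "set_integrable lborel {1..} (\<lambda>u::real. u powr (-1 - a))"
    using has_integral_powr_to_inf[of "-1 - a" 1] assms
    by (intro set_integrable_powr) (auto simp: integrable_on_def)
  have le: "1 - cos u \<le> u\<^sup>2" for u :: real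
  proof -
    have "1 - cos u = 2 * (sin (u/2))\<^sup>2"
      using cos_double_sin[of "u/2"] by simp
    also have "\<dots> \<le> 2 * (u/2)\<^sup>2"
      using abs_sin_x_le_abs_x[of "u/2"] unfolding abs_le_square_iff by simp
    also have "\<dots> \<le> u\<^sup>2" by (simp add: power2_eq_square)
    finally show ?thesis .
  qed
  show ?thesis
  proof (rule Bochner_Integration.integrable_bound)
    show "integrable lborel (\<lambda>u. indicator {0..1} u *\<^sub>R u powr (1 - a) + 2 * (indicator {1..} u *\<^sub>R u powr (-1 - a)))"
      using 1 2 unfolding set_integrable_def
      by (intro Bochner_Integration.integrable_add integrable_mult_right)
    show "AE u in lborel. norm (fbm_spectral a 1 u)
            \<le> norm (indicator {0..1} u *\<^sub>R u powr (1 - a) + 2 * (indicator {1..} u *\<^sub>R u powr (-1 - a)))"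
    proof (intro AE_I2)
      fix u :: real
      consider "u \<le> 0" | "0 < u" "u \<le> 1" | "1 < u" by linarith
      then show "norm (fbm_spectral a 1 u)
            \<le> norm (indicator {0..1} u *\<^sub>R u powr (1 - a) + 2 * (indicator {1..} u *\<^sub>R u powr (-1 - a)))"
      proof cases
        case 1 then show ?thesis by (simp add: fbm_spectral_def)
      next
        case 2
        have "norm (fbm_spectral a 1 u) = (1 - cos u) * u powr (-1 - a)"
          using 2 by (simp add: fbm_spectral_def abs_mult)
        also have "\<dots> \<le> u\<^sup>2 * u powr (-1 - a)" by (intro mult_right_mono le) auto
        also have "\<dots> = u powr (1 - a)"
          using 2 by (simp flip: powr_numeral powr_add)
        also have "\<dots> \<le> norm (indicator {0..1} u *\<^sub>R u powr (1 - a) + 2 * (indicator {1..} u *\<^sub>R u powr (-1 - a)))"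
          using 2 by (auto simp: indicator_def)
        finally show ?thesis .
      next
        case 3
        have "norm (fbm_spectral a 1 u) = (1 - cos u) * u powr (-1 - a)"
          using 3 by (simp add: fbm_spectral_def abs_mult)
        also have "\<dots> \<le> 2 * u powr (-1 - a)"
          using cos_ge_minus_one[of u] by (intro mult_right_mono) (auto simp del: cos_ge_minus_one)
        finally show ?thesis using 3 by (auto simp: indicator_def)
      qed
    qed
  qed auto
qed

text \<open>This homogeneity turns the single integral at t = 1 into all others. Evenness of the
  cosine lets \<open>\<bar>t\<bar>\<close> replace \<open>t\<close>, and the shape
  \<open>0 + \<bar>t\<bar> * u\<close> is that of the affine change of variables applied
  next.\<close>

lemma fbm_spectral_scale:
  "t \<noteq> 0 \<Longrightarrow> fbm_spectral a t u = \<bar>t\<bar> powr (1 + a) * fbm_spectral a 1 (0 + \<bar>t\<bar> * u)"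
proof -
  assume t: "t \<noteq> 0"
  have "cos (\<bar>t\<bar> * u) = cos (t * u)"
    by (cases "0 \<le> t") auto
  moreover have "\<bar>t\<bar> powr (1 + a) * (\<bar>t\<bar> * u) powr (-1 - a) = u powr (-1 - a)" if "0 < u"
    using t that by (simp add: powr_mult flip: powr_add mult.assoc)
  ultimately show ?thesis
    using t by (auto simp: fbm_spectral_def indicator_def zero_less_mult_iff)
qed

lemma fbm_spectral_0: "fbm_spectral a 0 u = 0"
  by (simp add: fbm_spectral_def)

lemma has_integral_fbm_spectral:
  assumes "0 < a" "a < 2"
  shows "has_bochner_integral lborel (fbm_spectral a t) (\<bar>t\<bar> powr a * fbm_const a)"
proof (cases "t = 0")
  case True
  then show ?thesis by (simp add: fbm_spectral_0[abs_def] has_bochner_integral_iff)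
next
  case False
  have "has_bochner_integral lborel (fbm_spectral a 1) (fbm_const a)"
    using integrable_fbm_spectral_1[OF assms] by (simp add: has_bochner_integral_iff fbm_const_def)
  then have "has_bochner_integral lborel (\<lambda>u. fbm_spectral a 1 (0 + \<bar>t\<bar> * u)) (fbm_const a /\<^sub>R \<bar>\<bar>t\<bar>\<bar>)"
    using False by (subst (asm) lborel_has_bochner_integral_real_affine_iff[of "\<bar>t\<bar>" _ _ 0]) simp_all
  from has_bochner_integral_mult_right[OF this, of "\<bar>t\<bar> powr (1 + a)"]
  have "has_bochner_integral lborel (\<lambda>u. \<bar>t\<bar> powr (1 + a) * fbm_spectral a 1 (0 + \<bar>t\<bar> * u))
      (\<bar>t\<bar> powr (1 + a) * (fbm_const a /\<^sub>R \<bar>\<bar>t\<bar>\<bar>))" .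
  moreover have "\<bar>t\<bar> powr (1 + a) * (fbm_const a /\<^sub>R \<bar>\<bar>t\<bar>\<bar>) = \<bar>t\<bar> powr a * fbm_const a"
    using False by (simp add: powr_add)
  ultimately show ?thesis
    unfolding fbm_spectral_scale[OF False, abs_def] by metis
qed

lemma integrable_cos_0_pi: "integrable lborel (\<lambda>u. indicator {0..pi} u * cos (t * u))"
  using borel_integrable_atLeastAtMost'[of 0 pi "\<lambda>u. cos (t * u)"]
  by (simp add: set_integrable_def continuous_on_cos continuous_on_mult)

text \<open>Sampling at integers produces integer frequencies, for which the cosines are orthogonal
  to constants on [0, pi]; this is why the spectrum is cut off at pi.\<close>

lemma integral_cos_0_pi:
  fixes m :: int
  shows "(LINT u|lborel. indicator {0..pi} u * cos (of_int m * u)) = (if m = 0 then pi else 0)"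
proof (cases "m = 0")
  case True then show ?thesis by simp
next
  case False
  have "(\<integral>u. indicator {0..pi} u *\<^sub>R cos (real_of_int m * u) \<partial>lborel) =
      sin (of_int m * pi) / of_int m - sin (of_int m * 0) / of_int m"
  proof (rule integral_FTC_Icc)
    show "continuous_on {0..pi} (\<lambda>u. cos (real_of_int m * u))"
      by (intro continuous_intros)
    fix x :: real
    show "((\<lambda>u. sin (of_int m * u) / of_int m) has_vector_derivative cos (of_int m * x)) (at x within {0..pi})"
      using False unfolding has_real_derivative_iff_has_vector_derivative[symmetric]
      by (auto intro!: derivative_eq_intros)
  qed auto
  then show ?thesis using False by (simp add: sin_integer_2pi mult.commute)
qed

text \<open>On (0, pi] the weight u^(-1-a) is at least pi^(-1-a), and 1 - cos u has integral pi
  there; elsewhere the integrand is nonnegative.\<close>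

lemma fbm_const_pos:
  assumes "0 < a" "a < 2"
  shows "0 < fbm_const a"
proof -
  have "(LINT u|lborel. (indicator {0..pi} u * cos (of_int 0 * u) - indicator {0..pi} u * cos (of_int 1 * u)) * pi powr (-1 - a)) \<le> fbm_const a"
    unfolding fbm_const_def
  proof (rule integral_mono)
    show "integrable lborel (\<lambda>u. (indicator {0..pi} u * cos (of_int 0 * u) - indicator {0..pi} u * cos (of_int 1 * u)) * pi powr (-1 - a))"
      using integrable_cos_0_pi[of 0] integrable_cos_0_pi[of 1]
      by (intro integrable_mult_left Bochner_Integration.integrable_diff) simp_all
    show "integrable lborel (fbm_spectral a 1)" by (rule integrable_fbm_spectral_1[OF assms])
    fix u :: real
    show "(indicator {0..pi} u * cos (of_int 0 * u) - indicator {0..pi} u * cos (of_int 1 * u)) * pi powr (-1 - a) \<le> fbm_spectral a 1 u"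
      using assms by (auto simp: fbm_spectral_def indicator_def intro!: mult_left_mono powr_mono2')
  qed
  moreover have "(LINT u|lborel. (indicator {0..pi} u * cos (of_int 0 * u) - indicator {0..pi} u * cos (of_int 1 * u)) * pi powr (-1 - a))
     = pi * pi powr (-1-a)"
    using integrable_cos_0_pi[of 0] integrable_cos_0_pi[of 1] integral_cos_0_pi[of 0] integral_cos_0_pi[of 1]
    by (simp)
  ultimately show ?thesis using pi_gt_zero by (smt (verit) mult_pos_pos powr_gt_zero)
qed


text \<open>Both sides are the squared modulus of the sum of b_k (1 - e^(iku)). The right side shows
  that the form is nonnegative at every frequency, so that frequencies may be discarded.\<close>

lemma trig_quadratic_form:
  fixes b :: "nat \<Rightarrow> real"
  shows "(\<Sum>j\<in>K. \<Sum>k\<in>K. b j * b k * (1 - cos (of_nat j * u) - cos (of_nat k * u) + cos ((of_nat j - of_nat k) * u)))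
    = (\<Sum>k\<in>K. b k * (1 - cos (of_nat k * u)))\<^sup>2 + (\<Sum>k\<in>K. b k * sin (of_nat k * u))\<^sup>2"
  unfolding power2_eq_square sum_product sum.distrib[symmetric]
  by (intro sum.cong refl) (simp add: cos_diff left_diff_distrib algebra_simps)

text \<open>Up to the factor \<open>fbm_const a\<close>, the quadratic form is the integral of
  u^(-1-a)/2 times the trigonometric form \<open>Q\<close> over u > 0. Keeping only u \<le> pi and
  replacing the weight by its minimum pi^(-1-a) leaves an integral of cosines that orthogonality
  evaluates exactly, whatever the size of \<open>K\<close>.\<close>

lemma fbm_cov_ge:
  fixes b :: "nat \<Rightarrow> real"
  assumes a: "0 < a" "a < 2" and K: "finite K" "0 \<notin> K"
  shows "pi powr (- a) / (2 * fbm_const a) * (\<Sum>k\<in>K. (b k)\<^sup>2)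
    \<le> (\<Sum>j\<in>K. \<Sum>k\<in>K. b j * b k * (1 / 2 * (of_nat j powr a + of_nat k powr a - \<bar>of_nat j - of_nat k\<bar> powr a)))"
    (is "_ \<le> ?V")
proof -
  define Q where "Q u = (\<Sum>j\<in>K. \<Sum>k\<in>K. b j * b k *
    (1 - cos (of_nat j * u) - cos (of_nat k * u) + cos ((of_nat j - of_nat k) * u)))" for u :: real
  define g where "g u = (\<Sum>j\<in>K. \<Sum>k\<in>K. b j * b k *
    (1 / 2 * (fbm_spectral a (of_nat j) u + fbm_spectral a (of_nat k) u - fbm_spectral a (of_nat j - of_nat k) u)))" for u :: real
  have Q0: "0 \<le> Q u" for u
    unfolding Q_def trig_quadratic_form by simp
  have g_eq: "g u = indicator {0<..} u * (u powr (-1 - a) / 2 * Q u)" for u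
    by (auto simp: g_def Q_def fbm_spectral_def sum_distrib_left algebra_simps intro!: sum.cong)
  have "has_bochner_integral lborel g
     (\<Sum>j\<in>K. \<Sum>k\<in>K. b j * b k * (1 / 2 * (\<bar>of_nat j\<bar> powr a * fbm_const a + \<bar>of_nat k\<bar> powr a * fbm_const a
        - \<bar>of_nat j - of_nat k\<bar> powr a * fbm_const a)))"
    unfolding g_def
    by (intro has_bochner_integral_sum has_bochner_integral_mult_right has_bochner_integral_diff
        has_bochner_integral_add has_integral_fbm_spectral a)
  also have "(\<Sum>j\<in>K. \<Sum>k\<in>K. b j * b k * (1 / 2 * (\<bar>of_nat j\<bar> powr a * fbm_const a + \<bar>of_nat k\<bar> powr a * fbm_const a
        - \<bar>of_nat j - of_nat k\<bar> powr a * fbm_const a))) = fbm_const a * ?V"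
    by (simp add: sum_distrib_left algebra_simps)
  finally have g: "has_bochner_integral lborel g (fbm_const a * ?V)" .
  have cos_int: "has_bochner_integral lborel (\<lambda>u. indicator {0..pi} u * cos (of_int m * u)) (if m = 0 then pi else 0)" for m
    using integrable_cos_0_pi[of "of_int m"] integral_cos_0_pi[of m] by (simp add: has_bochner_integral_iff)
  have "has_bochner_integral lborel (\<lambda>u. \<Sum>j\<in>K. \<Sum>k\<in>K. b j * b k *
     (indicator {0..pi} u * cos (of_int 0 * u) - indicator {0..pi} u * cos (of_int (int j) * u) -
      indicator {0..pi} u * cos (of_int (int k) * u) + indicator {0..pi} u * cos (of_int (int j - int k) * u)))
    (\<Sum>j\<in>K. \<Sum>k\<in>K. b j * b k * ((if 0 = (0::int) then pi else 0) - (if int j = 0 then pi else 0) - (if int k = 0 then pi else 0)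
        + (if int j - int k = 0 then pi else 0)))"
    by (intro has_bochner_integral_sum has_bochner_integral_mult_right has_bochner_integral_diff
        has_bochner_integral_add cos_int)
  also have "(\<lambda>u. \<Sum>j\<in>K. \<Sum>k\<in>K. b j * b k *
     (indicator {0..pi} u * cos (of_int 0 * u) - indicator {0..pi} u * cos (of_int (int j) * u) -
      indicator {0..pi} u * cos (of_int (int k) * u) + indicator {0..pi} u * cos (of_int (int j - int k) * u)))
    = (\<lambda>u. indicator {0..pi} u * Q u)"
    by (auto simp: Q_def fun_eq_iff indicator_def)
  \<comment> \<open>Since \<open>0 \<notin> K\<close>, the cosines of frequencies j and k integrate
    to zero. The constant term yields the all-ones form, the frequency j - k the diagonal.\<close>
  also have "(\<Sum>j\<in>K. \<Sum>k\<in>K. b j * b k * ((if 0 = (0::int) then pi else 0) - (if int j = 0 then pi else 0) - (if int k = 0 then pi else 0)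
        + (if int j - int k = 0 then pi else 0))) = (\<Sum>j\<in>K. \<Sum>k\<in>K. pi * (b j * b k) + (if j = k then pi * (b j)\<^sup>2 else 0))"
    using K(2) by (intro sum.cong refl) (auto simp: power2_eq_square algebra_simps)
  also have "\<dots> = (\<Sum>j\<in>K. \<Sum>k\<in>K. pi * (b j * b k)) + (\<Sum>k\<in>K. pi * (b k)\<^sup>2)"
    using K(1) by (simp add: sum.distrib)
  also have "\<dots> = pi * (\<Sum>k\<in>K. b k)\<^sup>2 + pi * (\<Sum>k\<in>K. (b k)\<^sup>2)"
    unfolding power2_eq_square sum_product unfolding sum_distrib_left ..
  finally have Q: "has_bochner_integral lborel (\<lambda>u. indicator {0..pi} u * Q u)
      (pi * (\<Sum>k\<in>K. b k)\<^sup>2 + pi * (\<Sum>k\<in>K. (b k)\<^sup>2))" .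
  have "pi powr (-1 - a) / 2 * (pi * (\<Sum>k\<in>K. b k)\<^sup>2 + pi * (\<Sum>k\<in>K. (b k)\<^sup>2)) \<le> fbm_const a * ?V"
  proof -
    \<comment> \<open>The point 0, where the indicator in \<open>g\<close> vanishes, is harmless
      because \<open>Q 0 = 0\<close>.\<close>
    have "pi powr (-1 - a) / 2 * (indicator {0..pi} u * Q u) \<le> g u" for u
      using Q0[of u] a unfolding g_eq
      by (cases "u = 0") (auto simp: indicator_def Q_def intro!: mult_right_mono powr_mono2')
    then have "(LINT u|lborel. pi powr (-1 - a) / 2 * (indicator {0..pi} u * Q u)) \<le> (LINT u|lborel. g u)"
      using g has_bochner_integral_mult_right[OF Q, of "pi powr (-1 - a) / 2"]
      by (intro integral_mono) (blast intro: integrable.intros)+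
    then show ?thesis
      by (simp only: has_bochner_integral_integral_eq[OF g]
          has_bochner_integral_integral_eq[OF has_bochner_integral_mult_right[OF Q]])
  qed
  \<comment> \<open>The all-ones form is a square and is dropped; the diagonal alone gives the
    bound.\<close>
  moreover have "pi powr (-1 - a) / 2 * (pi * (\<Sum>k\<in>K. (b k)\<^sup>2))
     \<le> pi powr (-1 - a) / 2 * (pi * (\<Sum>k\<in>K. b k)\<^sup>2 + pi * (\<Sum>k\<in>K. (b k)\<^sup>2))"
    by (intro mult_left_mono) auto
  moreover have "pi powr (-1 - a) / 2 * (pi * (\<Sum>k\<in>K. (b k)\<^sup>2)) = pi powr (- a) / 2 * (\<Sum>k\<in>K. (b k)\<^sup>2)"
    using powr_add[of pi "-1-a" 1] by simp
  ultimately have "pi powr (- a) / 2 * (\<Sum>k\<in>K. (b k)\<^sup>2) \<le> fbm_const a * ?V" by linarith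
  then show ?thesis
    using fbm_const_pos[OF a] by (simp add: field_simps)
qed

section \<open>A Gaussian small ball estimate\<close>

lemma (in prob_space) gaussian_rv_square_integrable:
  assumes "gaussian_rv M Y"
  shows "integrable M Y" "integrable M (\<lambda>\<omega>. (Y \<omega>)\<^sup>2)"
proof -
  have "integrable M Y \<and> integrable M (\<lambda>\<omega>. (Y \<omega>)\<^sup>2)"
  proof (cases "\<exists>\<mu>. AE \<omega> in M. Y \<omega> = \<mu>")
    case True
    then obtain \<mu> where \<mu>: "AE \<omega> in M. Y \<omega> = \<mu>" ..
    have [measurable]: "Y \<in> borel_measurable M" using assms by (simp add: gaussian_rv_def)
    have "integrable M Y \<longleftrightarrow> integrable M (\<lambda>_. \<mu>)"
      using \<mu> by (intro integrable_cong_AE) auto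
    moreover have "integrable M (\<lambda>\<omega>. (Y \<omega>)\<^sup>2) \<longleftrightarrow> integrable M (\<lambda>_. \<mu>\<^sup>2)"
      using \<mu> by (intro integrable_cong_AE) auto
    ultimately show ?thesis by simp
  next
    case False
    then obtain \<mu> \<sigma> where *: "0 < \<sigma>" "distributed M lborel Y (normal_density \<mu> \<sigma>)"
      using assms by (auto simp: gaussian_rv_def)
    have 1: "integrable M Y"
      using * integrable_normal_moment_nz_1[OF *(1), of \<mu>]
      by (intro distributed_integrable_var[OF *(2)]) auto
    have "integrable lborel (\<lambda>y. normal_density \<mu> \<sigma> y * (y - \<mu>)\<^sup>2)"
      by (rule integrable_normal_moment[OF *(1)])
    then have "integrable M (\<lambda>\<omega>. (Y \<omega> - \<mu>)\<^sup>2)"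
      by (subst (asm) distributed_integrable[OF *(2)]) auto
    then have "integrable M (\<lambda>\<omega>. (Y \<omega> - \<mu>)\<^sup>2 + (2 * \<mu> * Y \<omega> - \<mu>\<^sup>2))"
      using 1 by auto
    also have "(\<lambda>\<omega>. (Y \<omega> - \<mu>)\<^sup>2 + (2 * \<mu> * Y \<omega> - \<mu>\<^sup>2)) = (\<lambda>\<omega>. (Y \<omega>)\<^sup>2)"
      by (simp add: fun_eq_iff power2_eq_square algebra_simps)
    finally show ?thesis using 1 by simp
  qed
  then show "integrable M Y" "integrable M (\<lambda>\<omega>. (Y \<omega>)\<^sup>2)" by auto
qed

text \<open>Stated through the second moment so that one formula covers both the normal law and the
  degenerate law, where the second moment is 0.\<close>

lemma (in prob_space) centred_gaussian_char:
  assumes Y: "gaussian_rv M Y" and mean: "expectation Y = 0"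
  shows "(CLINT \<omega>|M. iexp (Y \<omega>)) = exp (- expectation (\<lambda>\<omega>. (Y \<omega>)\<^sup>2) / 2)"
proof (cases "\<exists>\<mu>. AE \<omega> in M. Y \<omega> = \<mu>")
  case True
  then obtain \<mu> where \<mu>: "AE \<omega> in M. Y \<omega> = \<mu>" ..
  have [measurable]: "Y \<in> borel_measurable M" using Y by (simp add: gaussian_rv_def)
  have "expectation Y = expectation (\<lambda>_. \<mu>)"
    using \<mu> by (intro integral_cong_AE) auto
  then have [simp]: "\<mu> = 0" using mean prob_space by simp
  have "expectation (\<lambda>\<omega>. (Y \<omega>)\<^sup>2) = expectation (\<lambda>_. 0)"
    using \<mu> by (intro integral_cong_AE) auto
  moreover have "(CLINT \<omega>|M. iexp (Y \<omega>)) = (CLINT \<omega>|M. 1)"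
    using \<mu> by (intro integral_cong_AE) auto
  ultimately show ?thesis using prob_space by simp
next
  case False
  then obtain \<mu> \<sigma> where *: "0 < \<sigma>" "distributed M lborel Y (normal_density \<mu> \<sigma>)"
    using Y by (auto simp: gaussian_rv_def)
  have "\<mu> = 0"
    using normal_distributed_expectation[OF *(1,2)] mean by simp
  have var: "expectation (\<lambda>\<omega>. (Y \<omega>)\<^sup>2) = \<sigma>\<^sup>2"
    using normal_distributed_variance[OF *(1,2)] mean by simp
  have "distributed M lborel (\<lambda>\<omega>. (Y \<omega> - \<mu>) / \<sigma>) std_normal_density"
    using normal_standard_normal_convert[OF *(1), of Y \<mu>] *(2) by simp
  then have "distr M lborel (\<lambda>\<omega>. Y \<omega> / \<sigma>) = std_normal_distribution" and
      [measurable]: "(\<lambda>\<omega>. Y \<omega> / \<sigma>) \<in> borel_measurable M"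
    by (auto simp: distributed_def \<open>\<mu> = 0\<close>)
  then have "char (distr M lborel (\<lambda>\<omega>. Y \<omega> / \<sigma>)) \<sigma> = exp (- (\<sigma>\<^sup>2) / 2)"
    by (simp add: char_std_normal_distribution)
  moreover have "char (distr M lborel (\<lambda>\<omega>. Y \<omega> / \<sigma>)) \<sigma> = (CLINT \<omega>|M. iexp (\<sigma> * (Y \<omega> / \<sigma>)))"
    unfolding char_def by (subst integral_distr) auto
  ultimately show ?thesis using var * by simp
qed

text \<open>Multiplying the standard normal density by this exponential gives 1/sqrt(1+v) times the
  centred normal density of variance 1/(1+v).\<close>

lemma std_normal_integral_exp_square:
  assumes "0 \<le> v"
  shows "(LINT g|std_normal_distribution. exp (- v * g\<^sup>2 / 2)) = 1 / sqrt (1 + v)"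
    and "integrable std_normal_distribution (\<lambda>g. exp (- v * g\<^sup>2 / 2))"
proof -
  define \<sigma> where "\<sigma> = 1 / sqrt (1 + v)"
  have \<sigma>: "0 < \<sigma>" "\<sigma>\<^sup>2 = 1 / (1 + v)" using assms by (auto simp: \<sigma>_def power_divide)
  have eq: "std_normal_density g * exp (- v * g\<^sup>2 / 2) = \<sigma> * normal_density 0 \<sigma> g" for g
  proof -
    have "- (g\<^sup>2) / 2 + - v * g\<^sup>2 / 2 = - (g\<^sup>2) / (2 * \<sigma>\<^sup>2)"
      using assms by (simp add: \<sigma> field_simps)
    then have "exp (- (g\<^sup>2) / 2) * exp (- v * g\<^sup>2 / 2) = exp (- (g\<^sup>2) / (2 * \<sigma>\<^sup>2))"
      by (simp only: mult_exp_exp)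
    then show ?thesis
      using \<sigma>(1) by (simp add: normal_density_def real_sqrt_mult)
  qed
  show "(LINT g|std_normal_distribution. exp (- v * g\<^sup>2 / 2)) = 1 / sqrt (1 + v)"
    using integral_normal_density[OF \<sigma>(1), of 0]
    by (subst integral_density) (auto simp: normal_density_nonneg eq[simplified] \<sigma>_def[symmetric])
  show "integrable std_normal_distribution (\<lambda>g. exp (- v * g\<^sup>2 / 2))"
    using integrable_normal_density[OF \<sigma>(1), of 0]
    by (subst integrable_density) (auto simp: normal_density_nonneg eq[simplified])
qed

text \<open>Only characteristic functions are bounded, so neither a joint density nor an inverse
  covariance matrix appears. After Fubini the auxiliary normals x_k act as the coefficients
  \<open>b k\<close>; the hypothesis decouples them into a product, and each factor contributes
  1/sqrt(1+v).\<close>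

lemma (in prob_space) gaussian_laplace_bound:
  fixes Y :: "nat \<Rightarrow> 'a \<Rightarrow> real"
  assumes K: "finite K" and [measurable]: "\<And>k. k \<in> K \<Longrightarrow> Y k \<in> borel_measurable M" and v: "0 \<le> v"
    and char: "\<And>b. norm (CLINT \<omega>|M. iexp (\<Sum>k\<in>K. b k * Y k \<omega>)) \<le> exp (- v * (\<Sum>k\<in>K. (b k)\<^sup>2) / 2)"
  shows "expectation (\<lambda>\<omega>. exp (- (\<Sum>k\<in>K. (Y k \<omega>)\<^sup>2) / 2)) \<le> (1 / sqrt (1 + v)) ^ card K"
proof -
  interpret N: prob_space std_normal_distribution
    by (rule prob_space_normal_density) simp
  interpret PN: product_prob_space "\<lambda>_::nat. std_normal_distribution" K
    by unfold_locales
  let ?P = "Pi\<^sub>M K (\<lambda>_. std_normal_distribution)"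
  interpret P: prob_space ?P by (rule PN.prob_space_axioms)
  interpret MP: pair_prob_space M ?P by unfold_locales
  have [measurable]: "(\<lambda>p. Y k (fst p)) \<in> borel_measurable (M \<Otimes>\<^sub>M ?P)" if "k \<in> K" for k
    using that by measurable
  have [measurable]: "(\<lambda>p. snd p k) \<in> borel_measurable (M \<Otimes>\<^sub>M ?P)" if "k \<in> K" for k
  proof -
    have "(\<lambda>p. snd p k) \<in> measurable (M \<Otimes>\<^sub>M ?P) std_normal_distribution"
      using that by measurable
    then show ?thesis by simp
  qed
  have meas: "(\<lambda>p. iexp (\<Sum>k\<in>K. snd p k * Y k (fst p))) \<in> borel_measurable (M \<Otimes>\<^sub>M ?P)"
    by measurable
  have iexp_int: "integrable std_normal_distribution (\<lambda>g. iexp (g * y))" for y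
    by (intro N.integrable_iexp) auto
  have gauss: "(CLINT g|std_normal_distribution. iexp (g * y)) = exp (- (y\<^sup>2) / 2)" for y
    using char_std_normal_distribution[THEN fun_cong, of y] by (simp add: char_def mult.commute)
  have "complex_of_real (expectation (\<lambda>\<omega>. exp (- (\<Sum>k\<in>K. (Y k \<omega>)\<^sup>2) / 2)))
     = (CLINT \<omega>|M. \<Prod>k\<in>K. CLINT g|std_normal_distribution. iexp (g * Y k \<omega>))"
    unfolding gauss integral_complex_of_real[symmetric]
    by (intro Bochner_Integration.integral_cong refl)
       (simp add: exp_sum[OF K, symmetric] sum_negf sum_divide_distrib flip: of_real_prod)
  also have "\<dots> = (CLINT \<omega>|M. CLINT x|?P. (\<Prod>k\<in>K. iexp (x k * Y k \<omega>)))"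
    by (subst PN.product_integral_prod[OF K iexp_int]) simp
  also have "\<dots> = (CLINT \<omega>|M. CLINT x|?P. iexp (\<Sum>k\<in>K. x k * Y k \<omega>))"
    by (simp add: exp_sum[OF K, symmetric] sum_distrib_left)
  also have "\<dots> = (CLINT x|?P. CLINT \<omega>|M. iexp (\<Sum>k\<in>K. x k * Y k \<omega>))"
    by (intro MP.Fubini_integral[symmetric] MP.P.integrable_const_bound[where B=1])
       (use meas in \<open>auto simp: case_prod_unfold\<close>)
  finally have eq: "complex_of_real (expectation (\<lambda>\<omega>. exp (- (\<Sum>k\<in>K. (Y k \<omega>)\<^sup>2) / 2)))
     = (CLINT x|?P. CLINT \<omega>|M. iexp (\<Sum>k\<in>K. x k * Y k \<omega>))" .
  \<comment> \<open>The complex integral in \<open>eq\<close> has a nonnegative real value, so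
    nothing is lost by passing to its modulus, where \<open>char\<close> applies pointwise in
    x.\<close>
  have "expectation (\<lambda>\<omega>. exp (- (\<Sum>k\<in>K. (Y k \<omega>)\<^sup>2) / 2))
     \<le> norm (CLINT x|?P. CLINT \<omega>|M. iexp (\<Sum>k\<in>K. x k * Y k \<omega>))"
    unfolding eq[symmetric] norm_of_real by (rule abs_ge_self)
  also have "\<dots> \<le> (LINT x|?P. (\<Prod>k\<in>K. exp (- v * (x k)\<^sup>2 / 2)))"
  proof (rule order_trans[OF integral_norm_bound integral_mono])
    show int: "integrable ?P (\<lambda>x. \<Prod>k\<in>K. exp (- v * (x k)\<^sup>2 / 2))"
      by (intro PN.product_integrable_prod K std_normal_integral_exp_square v)
    show "integrable ?P (\<lambda>x. norm (CLINT \<omega>|M. iexp (\<Sum>k\<in>K. x k * Y k \<omega>)))"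
      by (intro integrable_norm MP.integrable_snd MP.P.integrable_const_bound[where B=1])
         (use meas in \<open>auto simp: case_prod_unfold\<close>)
    fix x
    show "norm (CLINT \<omega>|M. iexp (\<Sum>k\<in>K. x k * Y k \<omega>)) \<le> (\<Prod>k\<in>K. exp (- v * (x k)\<^sup>2 / 2))"
      using char[of x] by (simp add: exp_sum[OF K, symmetric] sum_negf sum_divide_distrib sum_distrib_left)
  qed
  also have "\<dots> = (1 / sqrt (1 + v)) ^ card K"
    by (subst PN.product_integral_prod[OF K std_normal_integral_exp_square(2)[OF v]])
       (use std_normal_integral_exp_square(1)[OF v] in simp)
  finally show ?thesis .
qed

text \<open>Exponential Markov inequality: on the event the sum of squares is at most
  \<open>card K\<close>, which costs e^(1/2) per point, while \<open>exp 2 \<le> v\<close> makes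
  each Laplace factor at most e^(-1). The net gain is e^(-1/2) per point.\<close>

lemma (in prob_space) gaussian_small_ball:
  fixes Y :: "nat \<Rightarrow> 'a \<Rightarrow> real"
  assumes K: "finite K" and [measurable]: "\<And>k. k \<in> K \<Longrightarrow> Y k \<in> borel_measurable M"
    and v: "exp 2 \<le> v"
    and char: "\<And>b. norm (CLINT \<omega>|M. iexp (\<Sum>k\<in>K. b k * Y k \<omega>)) \<le> exp (- v * (\<Sum>k\<in>K. (b k)\<^sup>2) / 2)"
  shows "prob {\<omega>\<in>space M. \<forall>k\<in>K. \<bar>Y k \<omega>\<bar> \<le> 1} \<le> exp (- (of_nat (card K) / 2))"
proof -
  let ?E = "{\<omega>\<in>space M. \<forall>k\<in>K. \<bar>Y k \<omega>\<bar> \<le> 1}"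
  let ?n = "real (card K)"
  have v0: "0 \<le> v" using v by (meson exp_ge_zero order_trans)
  have E [measurable]: "?E \<in> events" using K by measurable
  have "exp (- ?n / 2) * prob ?E = expectation (\<lambda>\<omega>. exp (- ?n / 2) * indicator ?E \<omega>)"
    by simp
  also have "\<dots> \<le> expectation (\<lambda>\<omega>. exp (- (\<Sum>k\<in>K. (Y k \<omega>)\<^sup>2) / 2))"
  proof (rule integral_mono)
    show "integrable M (\<lambda>\<omega>. exp (- (\<Sum>k\<in>K. (Y k \<omega>)\<^sup>2) / 2))"
      by (rule integrable_const_bound[where B=1]) (auto intro!: sum_nonneg)
    fix \<omega> assume "\<omega> \<in> space M"
    show "exp (- ?n / 2) * indicator ?E \<omega> \<le> exp (- (\<Sum>k\<in>K. (Y k \<omega>)\<^sup>2) / 2)"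
    proof (cases "\<omega> \<in> ?E")
      case True
      then have "(\<Sum>k\<in>K. (Y k \<omega>)\<^sup>2) \<le> (\<Sum>k\<in>K. 1)"
        by (intro sum_mono) (simp add: abs_square_le_1)
      then show ?thesis using True by simp
    qed simp
  qed (auto simp: less_top[symmetric])
  also have "\<dots> \<le> (1 / sqrt (1 + v)) ^ card K"
    by (rule gaussian_laplace_bound[OF K _ v0 char]) auto
  also have "\<dots> \<le> exp (-1) ^ card K"
  proof (rule power_mono)
    have "exp 2 = (exp (1::real))\<^sup>2" by (simp flip: exp_double)
    then have "exp 1 = sqrt (exp 2)" by simp
    also have "\<dots> \<le> sqrt (1 + v)" using v by simp
    finally show "1 / sqrt (1 + v) \<le> exp (-1)" using v0
      by (simp add: exp_minus field_simps)
  qed (use v0 in simp)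
  also have "\<dots> = exp (- ?n / 2) * exp (- (?n / 2))"
    by (simp add: exp_of_nat_mult[symmetric] mult_exp_exp)
  finally show ?thesis by simp
qed

section \<open>Increments of the sheet along a coordinate direction\<close>

text \<open>In the coordinates other than \<open>i\<close> both points agree, so the factor is (x +
  x - 0)/2 with x = s_l^(2 H_l), the zero being \<open>0 powr y = 0\<close>. What remains is a
  constant times a one-parameter fractional Brownian covariance.\<close>

lemma fbs_cov_line:
  fixes s H :: "real^'n"
  shows "fbs_cov H (s + u *\<^sub>R axis i 1) (s + w *\<^sub>R axis i 1) =
    (\<Prod>l\<in>UNIV - {i}. (s $ l) powr (2 * H $ l)) *
    (1 / 2 * ((s $ i + u) powr (2 * H $ i) + (s $ i + w) powr (2 * H $ i) - \<bar>u - w\<bar> powr (2 * H $ i)))"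
proof -
  have "(\<Prod>l\<in>UNIV - {i}. 1 / 2 * (((s + u *\<^sub>R axis i 1) $ l) powr (2 * H $ l) + ((s + w *\<^sub>R axis i 1) $ l) powr (2 * H $ l)
      - \<bar>(s + u *\<^sub>R axis i 1) $ l - (s + w *\<^sub>R axis i 1) $ l\<bar> powr (2 * H $ l)))
      = (\<Prod>l\<in>UNIV - {i}. (s $ l) powr (2 * H $ l))"
    by (intro prod.cong refl) (auto simp: axis_def)
  then show ?thesis
    unfolding fbs_cov_def by (subst prod.remove[of _ i]) (simp_all add: axis_def)
qed

text \<open>\<open>gaussian_field\<close> attaches coefficients to parameter points; injectivity
  lets an index set carry them instead.\<close>

lemma (in prob_space) gaussian_field_combination:
  assumes X: "gaussian_field M T X" and J: "finite J" "inj_on p J" "p ` J \<subseteq> T"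
  shows "gaussian_rv M (\<lambda>\<omega>. \<Sum>k\<in>J. c k * X (p k) \<omega>)"
proof -
  have "gaussian_rv M (\<lambda>\<omega>. \<Sum>t\<in>p ` J. c (the_inv_into J p t) * X t \<omega>)"
    using X J unfolding gaussian_field_def by simp
  also have "(\<lambda>\<omega>. \<Sum>t\<in>p ` J. c (the_inv_into J p t) * X t \<omega>) = (\<lambda>\<omega>. \<Sum>k\<in>J. c k * X (p k) \<omega>)"
    using J by (auto simp: fun_eq_iff sum.reindex the_inv_into_f_f intro!: sum.cong)
  finally show ?thesis .
qed

lemma (in prob_space) gaussian_field_member:
  assumes "gaussian_field M T X" "t \<in> T"
  shows "gaussian_rv M (X t)"
  using gaussian_field_combination[OF assms(1), of "{()}" "\<lambda>_. t" "\<lambda>_. 1"] assms(2) by simp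

lemma (in prob_space) gaussian_field_mult_integrable:
  assumes "gaussian_field M T X" "s \<in> T" "t \<in> T"
  shows "integrable M (\<lambda>\<omega>. X s \<omega> * X t \<omega>)"
proof (rule Bochner_Integration.integrable_bound)
  note g = gaussian_field_member[OF assms(1)]
  show "integrable M (\<lambda>\<omega>. (X s \<omega>)\<^sup>2 + (X t \<omega>)\<^sup>2)"
    using gaussian_rv_square_integrable(2)[OF g] assms by auto
  show "(\<lambda>\<omega>. X s \<omega> * X t \<omega>) \<in> borel_measurable M"
    using gaussian_rv_square_integrable(1)[OF g] assms by auto
  have "\<bar>x * y\<bar> \<le> x\<^sup>2 + y\<^sup>2" for x y :: real
    using sum_squares_bound[of "\<bar>x\<bar>" "\<bar>y\<bar>"] mult_nonneg_nonneg[of "\<bar>x\<bar>" "\<bar>y\<bar>"]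
    by (simp add: abs_mult del: mult_nonneg_nonneg)
  then show "AE \<omega> in M. norm (X s \<omega> * X t \<omega>) \<le> norm ((X s \<omega>)\<^sup>2 + (X t \<omega>)\<^sup>2)"
    by (intro AE_I2) simp
qed

text \<open>Moving only in the positive direction keeps every sampled point in the parameter set,
  whatever the spacing and the number of points.\<close>

lemma line_point_nonneg:
  assumes "s \<in> pos_orthant" "0 \<le> u"
  shows "s + u *\<^sub>R axis i 1 \<in> nonneg_orthant"
  using assms by (auto simp: nonneg_orthant_def pos_orthant_def axis_def intro: less_imp_le add_nonneg_nonneg)

text \<open>In the mixed second difference of the covariance the one-point terms (s_i +
  k\<delta>)^(2 H_i) cancel, and homogeneity extracts the power of \<delta>. Index 0 is reserved for
  the base point, hence \<open>0 \<notin> K\<close>.\<close>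

lemma (in prob_space) fbs_line_increments:
  fixes X :: "real^'n \<Rightarrow> 'a \<Rightarrow> real" and b :: "nat \<Rightarrow> real" and i :: 'n
  assumes X: "real_fbs M H X" and s: "s \<in> pos_orthant" and \<delta>: "0 < \<delta>" and K: "finite K" "0 \<notin> K"
  defines "L \<equiv> (\<lambda>\<omega>. \<Sum>k\<in>K. b k * (X (s + (of_nat k * \<delta>) *\<^sub>R axis i 1) \<omega> - X s \<omega>))"
  shows "gaussian_rv M L" and "expectation L = 0"
    and "expectation (\<lambda>\<omega>. (L \<omega>)\<^sup>2) =
      (\<Prod>l\<in>UNIV - {i}. (s $ l) powr (2 * H $ l)) * \<delta> powr (2 * H $ i) *
      (\<Sum>j\<in>K. \<Sum>k\<in>K. b j * b k * (1 / 2 * (of_nat j powr (2 * H $ i) + of_nat k powr (2 * H $ i)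
        - \<bar>of_nat j - of_nat k\<bar> powr (2 * H $ i))))"
proof -
  define p where "p k = s + (of_nat k * \<delta>) *\<^sub>R axis i 1" for k
  define \<alpha> where "\<alpha> = 2 * H $ i"
  define A where "A = (\<Prod>l\<in>UNIV - {i}. (s $ l) powr (2 * H $ l))"
  have G: "gaussian_field M nonneg_orthant X"
    and mean: "\<And>t. t \<in> nonneg_orthant \<Longrightarrow> expectation (X t) = 0"
    and cov: "\<And>s t. s \<in> nonneg_orthant \<Longrightarrow> t \<in> nonneg_orthant \<Longrightarrow> expectation (\<lambda>\<omega>. X s \<omega> * X t \<omega>) = fbs_cov H s t"
    using X by (auto simp: real_fbs_def)
  have p: "p k \<in> nonneg_orthant" for k
    using s \<delta> by (simp add: p_def line_point_nonneg)
  have L: "L = (\<lambda>\<omega>. \<Sum>k\<in>K. b k * (X (p k) \<omega> - X (p 0) \<omega>))"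
    by (simp add: L_def p_def)
  have inj: "inj p"
    using \<delta> by (auto simp: inj_def p_def axis_def vec_eq_iff)
  \<comment> \<open>The base value is subtracted once for each \<open>k\<close>, so its total
    coefficient is \<open>- sum b K\<close>.\<close>
  have "gaussian_rv M (\<lambda>\<omega>. \<Sum>k\<in>insert 0 K. (if k = 0 then - sum b K else b k) * X (p k) \<omega>)"
    using K p by (intro gaussian_field_combination[OF G] inj_on_subset[OF inj]) auto
  also have "(\<lambda>\<omega>. \<Sum>k\<in>insert 0 K. (if k = 0 then - sum b K else b k) * X (p k) \<omega>) = L"
  proof
    fix \<omega>
    have "(\<Sum>k\<in>K. (if k = 0 then - sum b K else b k) * X (p k) \<omega>) = (\<Sum>k\<in>K. b k * X (p k) \<omega>)"
      using K by (intro sum.cong) auto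
    then show "(\<Sum>k\<in>insert 0 K. (if k = 0 then - sum b K else b k) * X (p k) \<omega>) = L \<omega>"
      using K by (simp add: L sum_subtractf right_diff_distrib sum_distrib_right)
  qed
  finally show "gaussian_rv M L" .
  have int: "integrable M (X (p k))" for k
    by (rule gaussian_rv_square_integrable(1)[OF gaussian_field_member[OF G p]])
  then show "expectation L = 0"
    unfolding L by (simp add: mean p)
  have int2: "integrable M (\<lambda>\<omega>. X (p j) \<omega> * X (p k) \<omega>)" for j k
    by (rule gaussian_field_mult_integrable[OF G p p])
  have expand: "(X (p j) \<omega> - X (p 0) \<omega>) * (X (p k) \<omega> - X (p 0) \<omega>) =
      X (p j) \<omega> * X (p k) \<omega> - X (p j) \<omega> * X (p 0) \<omega> - X (p 0) \<omega> * X (p k) \<omega> + X (p 0) \<omega> * X (p 0) \<omega>" for j k \<omega>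
    by (simp add: algebra_simps)
  have intd: "integrable M (\<lambda>\<omega>. (X (p j) \<omega> - X (p 0) \<omega>) * (X (p k) \<omega> - X (p 0) \<omega>))" for j k
    unfolding expand by (intro Bochner_Integration.integrable_add Bochner_Integration.integrable_diff int2)
  have covd: "expectation (\<lambda>\<omega>. (X (p j) \<omega> - X (p 0) \<omega>) * (X (p k) \<omega> - X (p 0) \<omega>)) =
      A * \<delta> powr \<alpha> * (1 / 2 * (of_nat j powr \<alpha> + of_nat k powr \<alpha> - \<bar>of_nat j - of_nat k\<bar> powr \<alpha>))" for j k
  proof -
    have c: "fbs_cov H (p j) (p k) = A * (1 / 2 * ((s $ i + of_nat j * \<delta>) powr \<alpha> + (s $ i + of_nat k * \<delta>) powr \<alpha>
        - \<bar>of_nat j * \<delta> - of_nat k * \<delta>\<bar> powr \<alpha>))" for j k :: nat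
      unfolding p_def fbs_cov_line A_def \<alpha>_def ..
    have sc: "\<bar>of_nat j * \<delta> - of_nat k * \<delta>\<bar> powr \<alpha> = \<bar>of_nat j - of_nat k\<bar> powr \<alpha> * \<delta> powr \<alpha>" for j k :: nat
      using \<delta> by (simp add: abs_mult powr_mult flip: left_diff_distrib)
    have "expectation (\<lambda>\<omega>. (X (p j) \<omega> - X (p 0) \<omega>) * (X (p k) \<omega> - X (p 0) \<omega>)) =
       fbs_cov H (p j) (p k) - fbs_cov H (p j) (p 0) - fbs_cov H (p 0) (p k) + fbs_cov H (p 0) (p 0)"
      unfolding expand by (simp add: int2 cov p)
    also have "\<dots> = A * \<delta> powr \<alpha> * (1 / 2 * (of_nat j powr \<alpha> + of_nat k powr \<alpha> - \<bar>of_nat j - of_nat k\<bar> powr \<alpha>))"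
      unfolding c sc by (simp add: algebra_simps)
    finally show ?thesis .
  qed
  have "expectation (\<lambda>\<omega>. (L \<omega>)\<^sup>2) =
      expectation (\<lambda>\<omega>. \<Sum>j\<in>K. \<Sum>k\<in>K. b j * b k * ((X (p j) \<omega> - X (p 0) \<omega>) * (X (p k) \<omega> - X (p 0) \<omega>)))"
    by (simp add: L power2_eq_square sum_product mult_ac)
  also have "\<dots> = (\<Sum>j\<in>K. \<Sum>k\<in>K. b j * b k *
      (A * \<delta> powr \<alpha> * (1 / 2 * (of_nat j powr \<alpha> + of_nat k powr \<alpha> - \<bar>of_nat j - of_nat k\<bar> powr \<alpha>))))"
    by (simp add: intd covd)
  also have "\<dots> = A * \<delta> powr \<alpha> * (\<Sum>j\<in>K. \<Sum>k\<in>K. b j * b k *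
      (1 / 2 * (of_nat j powr \<alpha> + of_nat k powr \<alpha> - \<bar>of_nat j - of_nat k\<bar> powr \<alpha>)))"
    unfolding sum_distrib_left by (intro sum.cong refl) (simp add: mult_ac)
  finally show "expectation (\<lambda>\<omega>. (L \<omega>)\<^sup>2) =
      (\<Prod>l\<in>UNIV - {i}. (s $ l) powr (2 * H $ l)) * \<delta> powr (2 * H $ i) *
      (\<Sum>j\<in>K. \<Sum>k\<in>K. b j * b k * (1 / 2 * (of_nat j powr (2 * H $ i) + of_nat k powr (2 * H $ i)
        - \<bar>of_nat j - of_nat k\<bar> powr (2 * H $ i))))"
    unfolding A_def \<alpha>_def .
qed

lemma (in prob_space) fbs_measurable:
  assumes "real_fbs M H X" "t \<in> nonneg_orthant"
  shows "X t \<in> borel_measurable M"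
  using gaussian_field_member[of _ X t] assms unfolding real_fbs_def gaussian_rv_def by blast

text \<open>Dividing the increments by \<open>x\<close> reduces the claim to thresholds 1. The
  assumption \<open>le\<close> then lifts the variance bound of \<open>fbm_cov_ge\<close> to
  \<open>exp 2\<close> times the sum of squared coefficients.\<close>

lemma (in prob_space) fbs_small_ball:
  fixes X :: "real^'n \<Rightarrow> 'a \<Rightarrow> real" and i :: 'n
  assumes X: "real_fbs M H X" and s: "s \<in> pos_orthant" and \<delta>: "0 < \<delta>" and x: "0 < x"
    and H: "0 < H $ i" "H $ i < 1"
    and le: "exp 2 * x\<^sup>2 \<le> (\<Prod>l\<in>UNIV - {i}. (s $ l) powr (2 * H $ l)) * \<delta> powr (2 * H $ i) *
       (pi powr (- (2 * H $ i)) / (2 * fbm_const (2 * H $ i)))"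
  shows "prob {\<omega>\<in>space M. \<forall>k\<in>{1..m}. \<bar>X (s + (of_nat k * \<delta>) *\<^sub>R axis i 1) \<omega> - X s \<omega>\<bar> \<le> x}
     \<le> exp (- (of_nat m / 2))"
proof -
  define A where "A = (\<Prod>l\<in>UNIV - {i}. (s $ l) powr (2 * H $ l)) * \<delta> powr (2 * H $ i)"
  define Y where "Y k \<omega> = (X (s + (of_nat k * \<delta>) *\<^sub>R axis i 1) \<omega> - X s \<omega>) / x" for k :: nat and \<omega>
  have A: "0 \<le> A" by (auto simp: A_def intro!: mult_nonneg_nonneg prod_nonneg)
  have "prob {\<omega>\<in>space M. \<forall>k\<in>{1..m}. \<bar>Y k \<omega>\<bar> \<le> 1} \<le> exp (- (of_nat (card {1..m}) / 2))"
  proof (rule gaussian_small_ball)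
    fix k assume "k \<in> {1..m}"
    show "Y k \<in> borel_measurable M"
      using fbs_measurable[OF X line_point_nonneg[OF s], of "of_nat k * \<delta>" i]
        fbs_measurable[OF X line_point_nonneg[OF s, of 0 i]] \<delta>
      unfolding Y_def by simp
  next
    fix b :: "nat \<Rightarrow> real"
    define L where "L \<omega> = (\<Sum>k\<in>{1..m}. (b k / x) * (X (s + (of_nat k * \<delta>) *\<^sub>R axis i 1) \<omega> - X s \<omega>))" for \<omega>
    note L = fbs_line_increments[OF X s \<delta>, of "{1..m}" "\<lambda>k. b k / x" i, folded L_def A_def]
    have "exp 2 * (\<Sum>k\<in>{1..m}. (b k)\<^sup>2) = exp 2 * x\<^sup>2 * (\<Sum>k\<in>{1..m}. (b k / x)\<^sup>2)"
      using x by (simp add: power_divide flip: sum_divide_distrib)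
    also have "\<dots> \<le> A * (pi powr (- (2 * H $ i)) / (2 * fbm_const (2 * H $ i))) * (\<Sum>k\<in>{1..m}. (b k / x)\<^sup>2)"
      using le unfolding A_def by (intro mult_right_mono sum_nonneg) auto
    also have "\<dots> \<le> expectation (\<lambda>\<omega>. (L \<omega>)\<^sup>2)"
      using mult_left_mono[OF fbm_cov_ge[of "2 * H $ i" "{1..m}" "\<lambda>k. b k / x"] A] H
      by (subst L(3)) (simp_all add: mult.assoc)
    finally have var: "exp 2 * (\<Sum>k\<in>{1..m}. (b k)\<^sup>2) \<le> expectation (\<lambda>\<omega>. (L \<omega>)\<^sup>2)" .
    have "(\<lambda>\<omega>. \<Sum>k\<in>{1..m}. b k * Y k \<omega>) = L"
      by (simp add: L_def Y_def fun_eq_iff)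
    then have "(CLINT \<omega>|M. iexp (\<Sum>k\<in>{1..m}. b k * Y k \<omega>)) = (CLINT \<omega>|M. iexp (L \<omega>))"
      by (simp only: fun_eq_iff)
    also have "\<dots> = exp (- expectation (\<lambda>\<omega>. (L \<omega>)\<^sup>2) / 2)"
      by (rule centred_gaussian_char) (use L in auto)
    finally show "norm (CLINT \<omega>|M. iexp (\<Sum>k\<in>{1..m}. b k * Y k \<omega>)) \<le> exp (- exp 2 * (\<Sum>k\<in>{1..m}. (b k)\<^sup>2) / 2)"
      using var by (simp del: of_real_exp)
  qed auto
  then show ?thesis
    using x by (simp add: Y_def)
qed

text \<open>The factor from the fixed coordinates is smallest at the lower corner of the interval,
  where it is still positive; this gives one \<kappa> for all base points. A threshold proportional
  to \<open>\<delta> powr (H $ i)\<close> makes the powers of \<delta> cancel from the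
  condition.\<close>

lemma (in prob_space) fbs_small_ball_uniform:
  fixes X :: "real^'n \<Rightarrow> 'a \<Rightarrow> real" and i :: 'n
  assumes X: "real_fbs M H X" and I: "I \<in> pos_intervals" and H: "\<And>l. 0 < H $ l" "H $ i < 1"
  shows "\<exists>\<kappa>>0. \<forall>s\<in>I. \<forall>\<delta>>0. \<forall>m.
      prob {\<omega>\<in>space M. \<forall>k\<in>{1..m}. \<bar>X (s + (of_nat k * \<delta>) *\<^sub>R axis i 1) \<omega> - X s \<omega>\<bar> \<le> \<kappa> * \<delta> powr (H $ i)}
      \<le> exp (- (of_nat m / 2))"
proof -
  obtain a b where ab: "I = cbox a b" "\<And>j. a $ j < b $ j" "cbox a b \<subseteq> pos_orthant"
    using I by (auto simp: pos_intervals_def)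
  have "a \<in> cbox a b" using ab(2) by (auto simp: mem_box_cart intro: less_imp_le)
  then have a: "0 < a $ l" for l using ab(3) by (auto simp: pos_orthant_def)
  define A where "A = (\<Prod>l\<in>UNIV - {i}. (a $ l) powr (2 * H $ l))"
  define d where "d = pi powr (- (2 * H $ i)) / (2 * fbm_const (2 * H $ i))"
  have "0 < A" using a unfolding A_def by (intro prod_pos) (simp add: less_imp_neq[symmetric])
  have "0 < d" using fbm_const_pos[of "2 * H $ i"] H(1)[of i] H(2) by (simp add: d_def)
  \<comment> \<open>Chosen to give equality in the condition of \<open>fbs_small_ball\<close> at the
    lower corner.\<close>
  define \<kappa> where "\<kappa> = sqrt (A * d / exp 2)"
  have \<kappa>: "0 < \<kappa>" "exp 2 * \<kappa>\<^sup>2 = A * d"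
    using \<open>0 < A\<close> \<open>0 < d\<close> by (simp_all add: \<kappa>_def)
  show ?thesis
  proof (intro exI[of _ \<kappa>] conjI \<kappa>(1) ballI allI impI)
    fix s and \<delta> :: real and m :: nat
    assume s: "s \<in> I" and \<delta>: "0 < \<delta>"
    have "exp 2 * (\<kappa> * \<delta> powr (H $ i))\<^sup>2 = A * \<delta> powr (2 * H $ i) * d"
      using \<kappa>(2) by (simp add: power_mult_distrib power2_eq_square mult_ac flip: powr_add)
    also have "\<dots> \<le> (\<Prod>l\<in>UNIV - {i}. (s $ l) powr (2 * H $ l)) * \<delta> powr (2 * H $ i) * d"
    proof (intro mult_right_mono)
      show "A \<le> (\<Prod>l\<in>UNIV - {i}. (s $ l) powr (2 * H $ l))"
        unfolding A_def using s a H(1) ab(1)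
        by (intro prod_mono conjI powr_mono2) (auto simp: mem_box_cart less_imp_le)
    qed (use \<open>0 < d\<close> in auto)
    finally show "prob {\<omega>\<in>space M. \<forall>k\<in>{1..m}. \<bar>X (s + (of_nat k * \<delta>) *\<^sub>R axis i 1) \<omega> - X s \<omega>\<bar> \<le> \<kappa> * \<delta> powr (H $ i)}
      \<le> exp (- (of_nat m / 2))"
      using s ab \<kappa>(1) \<delta> H unfolding d_def by (intro fbs_small_ball[OF X]) auto
  qed
qed

section \<open>Nets and scales\<close>

text \<open>A regular grid. Its nodes lie in the box, so that estimates on the box apply to them,
  and \<open>C\<close> does not depend on \<epsilon>, so that all scales are counted at
  once.\<close>

lemma box_net:
  fixes a b :: "real^'n"
  assumes ab: "\<And>l. a $ l < b $ l"
  obtains C where "0 < C" and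
    "\<And>\<epsilon>. 0 < \<epsilon> \<Longrightarrow> \<epsilon> \<le> 1 \<Longrightarrow> \<exists>F. finite F \<and> F \<subseteq> cbox a b \<and> of_nat (card F) \<le> C * (1 / \<epsilon>) ^ CARD('n) \<and>
       (\<forall>s\<in>cbox a b. \<exists>s'\<in>F. dist s' s < \<epsilon>)"
proof -
  define D where "D = (\<Sum>l\<in>UNIV. b $ l - a $ l)"
  have D: "0 \<le> D" using ab unfolding D_def by (intro sum_nonneg) (simp add: less_imp_le)
  show thesis
  proof (rule that[of "(D + 2) ^ CARD('n)"])
    show "0 < (D + 2) ^ CARD('n)" using D by simp
    fix \<epsilon> :: real
    assume \<epsilon>: "0 < \<epsilon>" "\<epsilon> \<le> 1"
    \<comment> \<open>Makes the l1-diameter D/p of a cell smaller than \<epsilon>;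
      \<open>\<epsilon> \<le> 1\<close> absorbs the additive 2 when p + 1 is bounded by (D +
      2)/\<epsilon>.\<close>
    define p where "p = nat \<lfloor>D / \<epsilon>\<rfloor> + 1"
    have p: "D / \<epsilon> < real p" "real p + 1 \<le> (D + 2) / \<epsilon>"
    proof -
      have "0 \<le> D / \<epsilon>" using D \<epsilon> by simp
      then have "real (nat \<lfloor>D / \<epsilon>\<rfloor>) = of_int \<lfloor>D / \<epsilon>\<rfloor>" by simp
      moreover have "2 \<le> 2 / \<epsilon>" using \<epsilon> by (simp add: field_simps)
      ultimately show "D / \<epsilon> < real p" "real p + 1 \<le> (D + 2) / \<epsilon>"
        unfolding p_def add_divide_distrib by linarith+
    qed
    have p0: "0 < real p" by (simp add: p_def)
    define node where "node f = (\<chi> l. a $ l + real (f l) / real p * (b $ l - a $ l))" for f :: "'n \<Rightarrow> nat"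
    define F where "F = node ` (PiE UNIV (\<lambda>_. {..p}))"
    have "finite F" by (simp add: F_def finite_PiE)
    moreover have "F \<subseteq> cbox a b"
    proof
      fix x assume "x \<in> F"
      then obtain f where f: "x = node f" "\<And>l. f l \<le> p" by (auto simp: F_def PiE_iff)
      have "0 \<le> real (f l) / real p * (b $ l - a $ l)" "real (f l) / real p * (b $ l - a $ l) \<le> 1 * (b $ l - a $ l)" for l
        using p0 f(2)[of l] ab[of l] by (intro mult_nonneg_nonneg mult_right_mono; simp)+
      then have "a $ l \<le> x $ l \<and> x $ l \<le> b $ l" for l
        unfolding f(1) node_def vec_lambda_beta by (smt (verit))
      then show "x \<in> cbox a b" by (simp add: mem_box_cart)
    qed
    moreover have "of_nat (card F) \<le> (D + 2) ^ CARD('n) * (1 / \<epsilon>) ^ CARD('n)"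
    proof -
      have "card F \<le> card (PiE UNIV (\<lambda>_::'n. {..p}))"
        unfolding F_def by (intro card_image_le) (simp add: finite_PiE)
      then have "real (card F) \<le> real (Suc p ^ CARD('n))"
        by (simp add: card_PiE del: of_nat_power of_nat_Suc)
      also have "\<dots> = (real p + 1) ^ CARD('n)" by (simp add: add.commute)
      also have "\<dots> \<le> ((D + 2) / \<epsilon>) ^ CARD('n)"
        using p by (intro power_mono) auto
      finally show ?thesis by (simp add: power_divide)
    qed
    moreover have "\<forall>s\<in>cbox a b. \<exists>s'\<in>F. dist s' s < \<epsilon>"
    proof
      fix s assume s: "s \<in> cbox a b"
      \<comment> \<open>Rounds each coordinate down, to the lower corner of a cell containing
        \<open>s\<close>.\<close>
      define f where "f l = nat \<lfloor>real p * (s $ l - a $ l) / (b $ l - a $ l)\<rfloor>" for l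
      have s': "a $ l \<le> s $ l" "s $ l \<le> b $ l" for l
        using s by (auto simp: mem_box_cart)
      have f: "real (f l) \<le> real p * (s $ l - a $ l) / (b $ l - a $ l)"
        "real p * (s $ l - a $ l) / (b $ l - a $ l) \<le> real (f l) + 1" for l
      proof -
        have "0 \<le> real p * (s $ l - a $ l) / (b $ l - a $ l)"
          using s'[of l] ab[of l] by simp
        then show "real (f l) \<le> real p * (s $ l - a $ l) / (b $ l - a $ l)"
          "real p * (s $ l - a $ l) / (b $ l - a $ l) \<le> real (f l) + 1"
          unfolding f_def by linarith+
      qed
      have "f l \<le> p" for l
      proof -
        have "real p * (s $ l - a $ l) / (b $ l - a $ l) \<le> real p"
          using s'[of l] ab[of l] by (simp add: divide_le_eq mult_left_mono)
        then show ?thesis using f(1)[of l] by linarith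
      qed
      then have "node f \<in> F" by (auto simp: F_def)
      have coord: "\<bar>(node f - s) $ l\<bar> \<le> (b $ l - a $ l) / real p" for l
      proof -
        have "real (f l) * (b $ l - a $ l) \<le> real p * (s $ l - a $ l)"
          "real p * (s $ l - a $ l) \<le> (real (f l) + 1) * (b $ l - a $ l)"
          using f[of l] ab[of l] by (simp_all add: pos_le_divide_eq pos_divide_le_eq)
        then have "real (f l) * (b $ l - a $ l) / real p \<le> s $ l - a $ l"
          "s $ l - a $ l \<le> (real (f l) + 1) * (b $ l - a $ l) / real p"
          using p0 by (simp_all add: pos_divide_le_eq pos_le_divide_eq mult.commute)
        then have "real (f l) / real p * (b $ l - a $ l) \<le> s $ l - a $ l"
          "s $ l - a $ l \<le> real (f l) / real p * (b $ l - a $ l) + (b $ l - a $ l) / real p"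
          by (simp_all add: add_divide_distrib distrib_right)
        then show ?thesis unfolding node_def by simp
      qed
      have "dist (node f) s \<le> (\<Sum>l\<in>UNIV. \<bar>(node f - s) $ l\<bar>)"
        unfolding dist_norm by (rule norm_le_l1_cart)
      also have "\<dots> \<le> D / real p"
        unfolding D_def sum_divide_distrib by (intro sum_mono coord)
      also have "\<dots> < \<epsilon>" using p(1) p0 \<epsilon> by (simp add: field_simps)
      finally show "\<exists>s'\<in>F. dist s' s < \<epsilon>" using \<open>node f \<in> F\<close> by blast
    qed
    ultimately show "\<exists>F. finite F \<and> F \<subseteq> cbox a b \<and> of_nat (card F) \<le> (D + 2) ^ CARD('n) * (1 / \<epsilon>) ^ CARD('n) \<and>
       (\<forall>s\<in>cbox a b. \<exists>s'\<in>F. dist s' s < \<epsilon>)" by blast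
  qed
qed

text \<open>Passes from the discrete scales e^(-n) to all small r, with n the integer part of -ln
  r.\<close>

lemma eventually_at_right_exp_scale:
  fixes P :: "real \<Rightarrow> bool"
  assumes "eventually Q sequentially"
    and "\<And>n r. Q n \<Longrightarrow> exp (- (of_nat n + 1)) < r \<Longrightarrow> r \<le> exp (- of_nat n) \<Longrightarrow> P r"
  shows "eventually P (at_right 0)"
proof -
  obtain N where N: "\<And>n. N \<le> n \<Longrightarrow> Q n"
    using assms(1) by (auto simp: eventually_sequentially)
  have "P r" if r: "0 < r" "r < exp (- of_nat N)" for r
  proof -
    define n where "n = nat \<lfloor>- ln r\<rfloor>"
    have lnr: "of_nat N < - ln r"
      using r ln_less_cancel_iff[of r "exp (- of_nat N)"] by simp
    then have "real n = of_int \<lfloor>- ln r\<rfloor>" by (simp add: n_def)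
    then have n: "of_nat n \<le> - ln r" "- ln r < of_nat n + 1" by linarith+
    have "N < Suc n" using lnr n by linarith
    then have "Q n" using N by simp
    moreover have "exp (- (of_nat n + 1)) < exp (ln r)" using n by simp
    moreover have "exp (ln r) \<le> exp (- of_nat n)" using n by simp
    ultimately show ?thesis using r assms(2) by simp
  qed
  then show ?thesis
    unfolding eventually_at_right_field by (intro exI[of _ "exp (- of_nat N)"]) simp
qed

text \<open>Here \<open>L\<close> is the logarithmic term of the gauge at \<open>r\<close>,
  \<open>g\<close> a lower bound for it in terms of \<open>n\<close>, and \<open>m\<close> the
  number of sampled points. The constant 2eq collects the halved radius, the factor e between
  consecutive scales, and the ratio \<open>q\<close> of points to \<open>g\<close>.\<close>

lemma gauge_le:
  fixes h g L q r :: real and m n :: nat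
  assumes h: "0 < h" and g: "0 < g" "g \<le> L" and r: "0 < r" "r \<le> exp (- of_nat n)"
    and m: "of_nat m + 1 \<le> q * g" and q: "0 < q"
  shows "(1 / (2 * exp 1 * q)) powr h * (r powr h * L powr (- h))
    \<le> (exp (- (of_nat n + 1)) / 2 / (of_nat m + 1)) powr h"
proof -
  have L: "0 < L" using g by simp
  have "(1 / (2 * exp 1 * q)) powr h * (r powr h * L powr (- h)) = (r / (2 * exp 1 * q * L)) powr h"
    using L q r by (simp add: powr_mult powr_divide powr_minus field_simps)
  also have "\<dots> \<le> (exp (- (of_nat n + 1)) / 2 / (of_nat m + 1)) powr h"
  proof (rule powr_mono2)
    have "r / (2 * exp 1 * q * L) \<le> exp (- of_nat n) / (2 * exp 1 * (q * g))"
      using r g q L by (intro frac_le) (auto simp: mult.assoc intro!: mult_left_mono)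
    also have "\<dots> \<le> exp (- of_nat n) / (2 * exp 1 * (of_nat m + 1))"
      using m g q by (intro frac_le mult_left_mono) auto
    also have "\<dots> = exp (- (of_nat n + 1)) / 2 / (of_nat m + 1)"
      by (simp add: exp_minus exp_add field_simps exp_diff)
    finally show "r / (2 * exp 1 * q * L) \<le> exp (- (of_nat n + 1)) / 2 / (of_nat m + 1)" .
  qed (use h L q r in auto)
  finally show ?thesis .
qed

text \<open>Dividing by m + 1 instead of m keeps even the last sampled point strictly inside the
  open ball.\<close>

lemma line_point_in_ball:
  fixes s :: "real^'n"
  assumes "0 < \<rho>" "k \<in> {1..m}"
  shows "s + (of_nat k * (\<rho> / (of_nat m + 1))) *\<^sub>R axis i 1 \<in> ball s \<rho>"
proof -
  have "real k * (\<rho> / (of_nat m + 1)) < \<rho>"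
    using assms mult_strict_left_mono[of "real k" "real m + 1" \<rho>] by (simp add: field_simps)
  then show ?thesis using assms by (simp add: dist_norm norm_axis_1)
qed

section \<open>Almost sure lower bounds\<close>

lemma (in prob_space) AE_eventually_not_small:
  fixes E :: "nat \<Rightarrow> 'a set"
  assumes [measurable]: "\<And>n. E n \<in> events" and "summable u" and "eventually (\<lambda>n. prob (E n) \<le> u n) sequentially"
  shows "AE \<omega> in M. eventually (\<lambda>n. \<omega> \<notin> E n) sequentially"
proof -
  have "summable (\<lambda>n. prob (E n))"
    by (rule summable_comparison_test_ev[OF _ assms(2)]) (use assms(3) in simp)
  then have "AE \<omega> in M. eventually (\<lambda>n. \<omega> \<in> space M - E n) sequentially"
    by (intro borel_cantelli_AE1) (auto simp: less_top[symmetric])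
  then show ?thesis
    by eventually_elim (auto elim: eventually_mono)
qed

lemma (in prob_space) fbs_small_event_measurable:
  assumes X: "real_fbs M H X" and s: "s \<in> pos_orthant" and \<delta>: "0 < \<delta>"
  shows "{\<omega>\<in>space M. \<forall>k\<in>{1..m::nat}. \<bar>X (s + (of_nat k * \<delta>) *\<^sub>R axis i 1) \<omega> - X s \<omega>\<bar> \<le> x} \<in> events"
proof -
  have [measurable]: "X (s + (of_nat k * \<delta>) *\<^sub>R axis i 1) \<in> borel_measurable M" for k :: nat
    using fbs_measurable[OF X line_point_nonneg[OF s]] \<delta> by simp
  have [measurable]: "X s \<in> borel_measurable M"
    using fbs_measurable[OF X line_point_nonneg[OF s, of 0]] by simp
  show ?thesis by measurable
qed

lemma (in prob_space) fbs_local_lower_bound: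
  fixes X :: "real^'n \<Rightarrow> 'a \<Rightarrow> real" and i :: 'n
  assumes X: "real_fbs M H X" and H: "0 < H $ i" and s: "s \<in> pos_orthant" and \<kappa>: "0 < \<kappa>"
    and small: "\<And>\<delta> m. 0 < \<delta> \<Longrightarrow>
      prob {\<omega>\<in>space M. \<forall>k\<in>{1..m}. \<bar>X (s + (of_nat k * \<delta>) *\<^sub>R axis i 1) \<omega> - X s \<omega>\<bar> \<le> \<kappa> * \<delta> powr (H $ i)}
      \<le> exp (- (of_nat m / 2))"
  shows "AE \<omega> in M. \<forall>\<^sub>F r in at_right 0. 0 < ln (ln (1 / r)) \<and> (\<exists>t\<in>ball s r \<inter> nonneg_orthant.
    \<kappa> * (1 / (2 * exp 1 * 6)) powr (H $ i) * (r powr (H $ i) * ln (ln (1 / r)) powr (- (H $ i))) \<le> \<bar>X t \<omega> - X s \<omega>\<bar>)"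
proof -
  \<comment> \<open>The factor 4 brings exp(-m/2) down to at most n^(-2), which is summable.\<close>
  define m where "m n = nat \<lceil>4 * ln (real n)\<rceil>" for n :: nat
  define \<rho> where "\<rho> n = exp (- (real n + 1)) / 2" for n :: nat
  define \<delta> where "\<delta> n = \<rho> n / (real (m n) + 1)" for n
  define E where "E n = {\<omega>\<in>space M. \<forall>k\<in>{1..m n}. \<bar>X (s + (of_nat k * \<delta> n) *\<^sub>R axis i 1) \<omega> - X s \<omega>\<bar> \<le> \<kappa> * \<delta> n powr (H $ i)}" for n
  have \<rho>: "0 < \<rho> n" for n by (simp add: \<rho>_def)
  have \<delta>: "0 < \<delta> n" for n using \<rho> by (simp add: \<delta>_def)
  have "AE \<omega> in M. eventually (\<lambda>n. \<omega> \<notin> E n) sequentially"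
  proof (rule AE_eventually_not_small)
    show "E n \<in> events" for n unfolding E_def by (rule fbs_small_event_measurable[OF X s \<delta>])
    show "summable (\<lambda>n. real n powr - 2)" by (subst summable_real_powr_iff) simp
    show "eventually (\<lambda>n. prob (E n) \<le> real n powr - 2) sequentially"
    proof (rule eventually_mono[OF eventually_gt_at_top[of 0]])
      fix n :: nat assume n: "0 < n"
      have "prob (E n) \<le> exp (- (of_nat (m n) / 2))"
        unfolding E_def by (rule small[OF \<delta>])
      also have "\<dots> \<le> exp (- 2 * ln n)"
        unfolding m_def by (simp; linarith)
      also have "\<dots> = real n powr - 2" using n by (simp add: powr_def)
      finally show "prob (E n) \<le> real n powr - 2" .
    qed
  qed
  then show ?thesis
    using AE_space
  proof eventually_elim
    case (elim \<omega>)
    show ?case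
    proof (rule eventually_at_right_exp_scale)
      \<comment> \<open>From n = 3 on, e \<le> n and hence ln n \<ge> 1, so that m + 1 < 4 ln n + 2
        \<le> 6 ln n; this is the 6 in the constant.\<close>
      show "eventually (\<lambda>n. \<omega> \<notin> E n \<and> 3 \<le> n) sequentially"
        using elim(1) eventually_ge_at_top[of 3] by eventually_elim simp
      fix n :: nat and r :: real
      assume n: "\<omega> \<notin> E n \<and> 3 \<le> n" and r: "exp (- (of_nat n + 1)) < r" "r \<le> exp (- of_nat n)"
      have r0: "0 < r" using r(1) by (meson exp_gt_zero order_less_trans)
      have "ln r \<le> - real n" using r0 r(2) by (metis ln_exp ln_mono)
      then have "ln (real n) \<le> ln (ln (1 / r))" using n r0 by (intro ln_mono) (simp_all add: ln_div)
      have "exp 1 \<le> real n" using n exp_le by linarith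
      then have lnn: "1 \<le> ln (real n)" using n by (simp add: ln_ge_iff)
      show "0 < ln (ln (1 / r)) \<and> (\<exists>t\<in>ball s r \<inter> nonneg_orthant.
        \<kappa> * (1 / (2 * exp 1 * 6)) powr (H $ i) * (r powr (H $ i) * ln (ln (1 / r)) powr (- (H $ i))) \<le> \<bar>X t \<omega> - X s \<omega>\<bar>)"
      proof
        show "0 < ln (ln (1 / r))" using lnn \<open>ln (real n) \<le> ln (ln (1 / r))\<close> by linarith
        obtain k where k: "k \<in> {1..m n}" and gt: "\<kappa> * \<delta> n powr (H $ i) < \<bar>X (s + (of_nat k * \<delta> n) *\<^sub>R axis i 1) \<omega> - X s \<omega>\<bar>"
          using n elim(2) unfolding E_def by (auto simp: not_le)
        have "\<kappa> * ((1 / (2 * exp 1 * 6)) powr (H $ i) * (r powr (H $ i) * ln (ln (1 / r)) powr (- (H $ i)))) \<le> \<kappa> * \<delta> n powr (H $ i)"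
          unfolding \<delta>_def \<rho>_def
        proof (intro mult_left_mono gauge_le[where g="ln (real n)"])
          have "0 \<le> 4 * ln (real n)" using lnn by simp
          then have "real (m n) < 4 * ln (real n) + 1" unfolding m_def by linarith
          then show "real (m n) + 1 \<le> 6 * ln (real n)" using lnn by linarith
        qed (use H r0 r lnn \<open>ln (real n) \<le> ln (ln (1 / r))\<close> \<kappa> in auto)
        then have le: "\<kappa> * (1 / (2 * exp 1 * 6)) powr (H $ i) * (r powr (H $ i) * ln (ln (1 / r)) powr (- (H $ i)))
            \<le> \<bar>X (s + (of_nat k * \<delta> n) *\<^sub>R axis i 1) \<omega> - X s \<omega>\<bar>"
          using gt by (simp only: mult.assoc)
        have "s + (of_nat k * \<delta> n) *\<^sub>R axis i 1 \<in> ball s (\<rho> n)"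
          unfolding \<delta>_def by (rule line_point_in_ball[OF \<rho> k])
        moreover have "\<rho> n \<le> r" using r(1) r0 unfolding \<rho>_def by linarith
        ultimately have "s + (of_nat k * \<delta> n) *\<^sub>R axis i 1 \<in> ball s r"
          using subset_ball by blast
        then show "\<exists>t\<in>ball s r \<inter> nonneg_orthant.
          \<kappa> * (1 / (2 * exp 1 * 6)) powr (H $ i) * (r powr (H $ i) * ln (ln (1 / r)) powr (- (H $ i))) \<le> \<bar>X t \<omega> - X s \<omega>\<bar>"
          using le line_point_nonneg[OF s, of "of_nat k * \<delta> n" i] \<delta>[of n] by auto
      qed
    qed
  qed
qed

text \<open>One null set serves all \<open>s\<close> in \<open>I\<close>, as nowhere
  differentiability demands. The factor 1/2 is the price of passing from a net point to a general
  base point.\<close>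

lemma (in prob_space) fbs_uniform_lower_bound:
  fixes X :: "real^'n \<Rightarrow> 'a \<Rightarrow> real" and i :: 'n
  assumes X: "real_fbs M H X" and H: "0 < H $ i" and I: "I \<in> pos_intervals" and \<kappa>: "0 < \<kappa>"
    and small: "\<And>s \<delta> m. s \<in> I \<Longrightarrow> 0 < \<delta> \<Longrightarrow>
      prob {\<omega>\<in>space M. \<forall>k\<in>{1..m}. \<bar>X (s + (of_nat k * \<delta>) *\<^sub>R axis i 1) \<omega> - X s \<omega>\<bar> \<le> \<kappa> * \<delta> powr (H $ i)}
      \<le> exp (- (of_nat m / 2))"
  shows "AE \<omega> in M. \<forall>\<^sub>F r in at_right 0. 0 < ln (1 / r) \<and> (\<forall>s\<in>I. \<exists>t\<in>ball s r \<inter> nonneg_orthant.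
    \<kappa> / 2 * (1 / (2 * exp 1 * (2 * CARD('n) + 3))) powr (H $ i) * (r powr (H $ i) * ln (1 / r) powr (- (H $ i))) \<le> \<bar>X t \<omega> - X s \<omega>\<bar>)"
proof -
  let ?N = "CARD('n)"
  obtain a b where ab: "I = cbox a b" "\<And>j. a $ j < b $ j" "cbox a b \<subseteq> pos_orthant"
    using I by (auto simp: pos_intervals_def)
  \<comment> \<open>With N = \<open>?N\<close>, each bad event has probability at most e^(-(N+1)n)
    and the net has at most a constant times e^(nN) points, so the union is left with a summable
    e^(-n).\<close>
  define m where "m n = 2 * (?N + 1) * n" for n :: nat
  \<comment> \<open>Half of the lower end of the window for r: the distance from \<open>s\<close> to
    a net point and from there to a sampled point must add up to less than r.\<close>
  define \<rho> where "\<rho> n = exp (- (real n + 1)) / 2" for n :: nat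
  define \<delta> where "\<delta> n = \<rho> n / (real (m n) + 1)" for n
  define E where "E n s = {\<omega>\<in>space M. \<forall>k\<in>{1..m n}. \<bar>X (s + (of_nat k * \<delta> n) *\<^sub>R axis i 1) \<omega> - X s \<omega>\<bar> \<le> \<kappa> * \<delta> n powr (H $ i)}" for n s
  have \<rho>: "0 < \<rho> n" "\<rho> n \<le> 1" for n
    using exp_le_one_iff[of "- (real n + 1)"] by (auto simp: \<rho>_def simp del: exp_le_one_iff)
  have \<delta>: "0 < \<delta> n" for n using \<rho> by (simp add: \<delta>_def)
  obtain C where C: "0 < C"
    "\<And>\<epsilon>. 0 < \<epsilon> \<Longrightarrow> \<epsilon> \<le> 1 \<Longrightarrow> \<exists>F. finite F \<and> F \<subseteq> cbox a b \<and> of_nat (card F) \<le> C * (1 / \<epsilon>) ^ ?N \<and>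
       (\<forall>s\<in>cbox a b. \<exists>s'\<in>F. dist s' s < \<epsilon>)"
    using box_net[of a b] ab(2) by metis
  from C(2)[OF \<rho>] obtain F where F: "\<And>n. finite (F n)" "\<And>n. F n \<subseteq> I" "\<And>n. real (card (F n)) \<le> C * (1 / \<rho> n) ^ ?N"
    "\<And>n s. s \<in> I \<Longrightarrow> \<exists>s'\<in>F n. dist s' s < \<rho> n"
    unfolding ab(1) by metis
  have Em [measurable]: "E n s \<in> events" if "s \<in> I" for n s
    unfolding E_def using that ab by (intro fbs_small_event_measurable[OF X _ \<delta>]) auto
  have "AE \<omega> in M. eventually (\<lambda>n. \<omega> \<notin> (\<Union>s\<in>F n. E n s)) sequentially"
  proof (rule AE_eventually_not_small)
    show "(\<Union>s\<in>F n. E n s) \<in> events" for n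
      using F(1) F(2)[of n] Em by (intro sets.finite_UN) blast+
    show "summable (\<lambda>n. C * (2 * exp 1) ^ ?N * exp (-1) ^ n)"
      by (intro summable_mult summable_geometric) simp
    have "prob (\<Union>s\<in>F n. E n s) \<le> C * (2 * exp 1) ^ ?N * exp (-1) ^ n" for n
    proof -
      have "prob (\<Union>s\<in>F n. E n s) \<le> (\<Sum>s\<in>F n. prob (E n s))"
        using F(1) F(2)[of n] Em by (intro finite_measure_subadditive_finite) blast+
      also have "\<dots> \<le> (\<Sum>s\<in>F n. exp (- (real (m n) / 2)))"
        unfolding E_def by (intro sum_mono small \<delta> subsetD[OF F(2)])
      also have "\<dots> = real (card (F n)) * exp (- (real (m n) / 2))" by simp
      also have "\<dots> \<le> C * (1 / \<rho> n) ^ ?N * exp (- (real (m n) / 2))"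
        by (intro mult_right_mono F) simp
      also have "1 / \<rho> n = 2 * exp 1 * exp (real n)"
        unfolding \<rho>_def exp_minus exp_add by (simp add: field_simps)
      also have "C * (2 * exp 1 * exp (real n)) ^ ?N * exp (- (real (m n) / 2))
          = C * (2 * exp 1) ^ ?N * (exp (real n) ^ ?N * exp (- (real (m n) / 2)))"
        by (simp add: power_mult_distrib)
      also have "exp (real n) ^ ?N * exp (- (real (m n) / 2)) = exp (-1) ^ n"
        unfolding exp_of_nat_mult[symmetric] mult_exp_exp by (simp add: m_def algebra_simps)
      finally show ?thesis .
    qed
    then show "eventually (\<lambda>n. prob (\<Union>s\<in>F n. E n s) \<le> C * (2 * exp 1) ^ ?N * exp (-1) ^ n) sequentially"
      by simp
  qed
  then show ?thesis
    using AE_space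
  proof eventually_elim
    case (elim \<omega>)
    show ?case
    proof (rule eventually_at_right_exp_scale)
      show "eventually (\<lambda>n. \<omega> \<notin> (\<Union>s\<in>F n. E n s) \<and> 1 \<le> n) sequentially"
        using elim(1) eventually_ge_at_top[of 1] by eventually_elim simp
      fix n :: nat and r :: real
      assume n: "\<omega> \<notin> (\<Union>s\<in>F n. E n s) \<and> 1 \<le> n" and r: "exp (- (of_nat n + 1)) < r" "r \<le> exp (- of_nat n)"
      have r0: "0 < r" using r(1) by (meson exp_gt_zero order_less_trans)
      have "ln r \<le> - real n" using r0 r(2) by (metis ln_exp ln_mono)
      then have L: "real n \<le> ln (1 / r)" using r0 by (simp add: ln_div)
      define y where "y = (1 / (2 * exp 1 * (2 * CARD('n) + 3))) powr (H $ i) * (r powr (H $ i) * ln (1 / r) powr (- (H $ i)))"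
      have "y \<le> \<delta> n powr (H $ i)"
        unfolding \<delta>_def \<rho>_def y_def
      proof (rule gauge_le[where g="real n"])
        \<comment> \<open>\<open>1 \<le> n\<close> absorbs the added 1; hence 2N + 3 in the
          constant.\<close>
        have "real (m n) + 1 \<le> 2 * (real ?N + 1) * real n + real n"
        proof -
          have "real (m n) = 2 * (real ?N + 1) * real n" by (simp add: m_def algebra_simps)
          then show ?thesis using n by simp
        qed
        also have "\<dots> = (2 * real ?N + 3) * real n" by (simp add: algebra_simps)
        finally show "real (m n) + 1 \<le> real (2 * ?N + 3) * real n" by simp
      qed (use n H r0 r L in auto)
      then have y: "\<kappa> * y \<le> \<kappa> * \<delta> n powr (H $ i)" using \<kappa> by simp
      have \<rho>r: "2 * \<rho> n \<le> r" using r(1) by (simp add: \<rho>_def)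
      have "\<exists>t\<in>ball s r \<inter> nonneg_orthant. \<kappa> / 2 * y \<le> \<bar>X t \<omega> - X s \<omega>\<bar>" if s: "s \<in> I" for s
      proof -
        obtain s' where s': "s' \<in> F n" "dist s' s < \<rho> n" using F(4)[OF s] by blast
        then have "s' \<in> I" using F(2) by blast
        then have s'pos: "s' \<in> pos_orthant" using ab by auto
        obtain k where k: "k \<in> {1..m n}" and gt: "\<kappa> * \<delta> n powr (H $ i) < \<bar>X (s' + (of_nat k * \<delta> n) *\<^sub>R axis i 1) \<omega> - X s' \<omega>\<bar>"
          using n s'(1) elim(2) unfolding E_def by (auto simp: not_le)
        define t where "t = s' + (of_nat k * \<delta> n) *\<^sub>R axis i 1"
        have "t \<in> ball s' (\<rho> n)"
          unfolding t_def \<delta>_def by (rule line_point_in_ball[OF \<rho>(1) k])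
        then have "dist t s < 2 * \<rho> n"
          using s'(2) dist_triangle[of t s s'] by (simp add: dist_commute)
        then have t: "t \<in> ball s r \<inter> nonneg_orthant"
          using \<rho>r line_point_nonneg[OF s'pos, of "of_nat k * \<delta> n" i] \<delta>[of n] by (auto simp: dist_commute t_def)
        have s'': "s' \<in> ball s r \<inter> nonneg_orthant"
          using \<rho>r \<rho>(1)[of n] s'(2) line_point_nonneg[OF s'pos, of 0 i] by (auto simp: dist_commute)
        have "\<kappa> * y < \<bar>X t \<omega> - X s' \<omega>\<bar>" using y gt by (simp add: t_def)
        \<comment> \<open>The increment from s' to t is the difference of the increments from s to t
          and from s to s', so these cannot both be below half of the bound.\<close>
        then have "\<kappa> / 2 * y \<le> \<bar>X t \<omega> - X s \<omega>\<bar> \<or> \<kappa> / 2 * y \<le> \<bar>X s' \<omega> - X s \<omega>\<bar>" by argo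
        then show ?thesis using t s'' by blast
      qed
      then show "0 < ln (1 / r) \<and> (\<forall>s\<in>I. \<exists>t\<in>ball s r \<inter> nonneg_orthant.
          \<kappa> / 2 * (1 / (2 * exp 1 * (2 * CARD('n) + 3))) powr (H $ i) * (r powr (H $ i) * ln (1 / r) powr (- (H $ i))) \<le> \<bar>X t \<omega> - X s \<omega>\<bar>)"
        using L n unfolding y_def by (simp add: mult.assoc)
    qed
  qed
qed

section \<open>Nowhere differentiability\<close>

text \<open>Reduces an almost sure statement on the open orthant to countably many compact
  intervals, with one null set each.\<close>

lemma pos_orthant_countable_cover:
  "\<exists>J :: nat \<Rightarrow> (real^'n) set. range J \<subseteq> pos_intervals \<and> pos_orthant \<subseteq> (\<Union>k. J k)"
proof (intro exI conjI)
  \<comment> \<open>The shift by 2 makes the cubes nondegenerate already at k = 0.\<close>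
  let ?J = "\<lambda>k::nat. cbox (\<chi> j. 1 / (real k + 2)) (\<chi> j. real k + 2) :: (real^'n) set"
  have "1 / (real k + 2) < real k + 2" for k
    by (rule less_trans[of _ 1]) auto
  moreover have "?J k \<subseteq> pos_orthant" for k
  proof
    fix x assume "x \<in> ?J k"
    then have "1 / (real k + 2) \<le> x $ j" for j by (simp add: mem_box_cart)
    moreover have "0 < 1 / (real k + 2)" by simp
    ultimately have "0 < x $ j" for j by (rule less_le_trans[rotated])
    then show "x \<in> pos_orthant" unfolding pos_orthant_def by simp
  qed
  ultimately have "?J k \<in> pos_intervals" for k
    unfolding pos_intervals_def by fastforce
  then show "range ?J \<subseteq> pos_intervals" by blast
  show "pos_orthant \<subseteq> (\<Union>k. ?J k)"
  proof
    fix s :: "real^'n" assume "s \<in> pos_orthant"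
    then have s: "0 < s $ j" for j by (auto simp: pos_orthant_def)
    define K where "K = Max (range (\<lambda>j. max (s $ j) (1 / s $ j)))"
    obtain k :: nat where k: "K \<le> real k" using real_arch_simple by blast
    have "1 / (real k + 2) \<le> s $ j \<and> s $ j \<le> real k + 2" for j
    proof -
      have "max (s $ j) (1 / s $ j) \<le> K"
        unfolding K_def by (intro Max_ge) auto
      then have *: "s $ j \<le> real k" "1 / s $ j \<le> real k + 2" using k by auto
      then have "1 / (real k + 2) \<le> 1 / (1 / s $ j)" using s[of j] by (intro divide_left_mono) auto
      then show ?thesis using * by simp
    qed
    then have "s \<in> ?J k" by (simp add: mem_box_cart)
    then show "s \<in> (\<Union>k. ?J k)" by blast
  qed
qed

text \<open>Differentiability at \<open>s\<close> bounds the increments over a ball of radius r by a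
  constant times r, which is of smaller order than the gauge because h < 1.\<close>

lemma not_differentiable_if_rough:
  fixes f :: "'a::real_normed_vector \<Rightarrow> 'b::real_normed_vector"
  assumes h: "0 < h" "h < 1" and c: "0 < c"
    and rough: "\<forall>\<^sub>F r in at_right 0. \<exists>t\<in>ball s r. c * (r powr h * ln (1 / r) powr (- h)) \<le> norm (f t - f s)"
  shows "\<not> f differentiable (at s)"
proof
  assume "f differentiable (at s)"
  then obtain f' where f': "(f has_derivative f') (at s)" by (auto simp: differentiable_def)
  then have bl: "bounded_linear f'" by (rule has_derivative_bounded_linear)
  obtain K where K: "0 < K" "\<And>x. norm (f' x) \<le> norm x * K"
    using bounded_linear.pos_bounded[OF bl] by blast
  obtain d where d: "0 < d" "\<And>t. norm (t - s) < d \<Longrightarrow> norm (f t - f s - f' (t - s)) \<le> 1 * norm (t - s)"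
    using f' unfolding has_derivative_at_alt by (metis zero_less_one)
  have lip: "norm (f t - f s) \<le> (1 + K) * norm (t - s)" if "norm (t - s) < d" for t
    using d(2)[OF that] K(2)[of "t - s"] norm_triangle_ineq[of "f t - f s - f' (t - s)" "f' (t - s)"]
    by (simp add: algebra_simps)
  \<comment> \<open>This is r divided by the gauge.\<close>
  have "((\<lambda>r. r powr (1 - h) * ln (1 / r) powr h) \<longlongrightarrow> 0) (at_right (0::real))"
    using h by real_asymp
  then have "\<forall>\<^sub>F r in at_right 0. r powr (1 - h) * ln (1 / r) powr h < c / (1 + K)"
    using c K(1) by (intro order_tendstoD(2)) auto
  moreover have "\<forall>\<^sub>F r in at_right 0. 0 < r \<and> r < min d 1"
    using d(1) by (intro eventually_at_rightI[of 0 "min d 1"]) auto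
  ultimately have "\<forall>\<^sub>F r in at_right (0::real). False"
    using rough
  proof eventually_elim
    case (elim r)
    have r: "0 < r" "r < d" "r < 1" using elim by auto
    then have L: "0 < ln (1 / r)" by simp
    obtain t where t: "t \<in> ball s r" "c * (r powr h * ln (1 / r) powr (- h)) \<le> norm (f t - f s)"
      using elim by blast
    have ts: "norm (t - s) < r" using t(1) by (simp add: dist_norm norm_minus_commute)
    have "norm (f t - f s) \<le> (1 + K) * r"
      using lip[of t] ts r K(1) by (smt (verit) mult_left_mono)
    then have "c * (r powr h * ln (1 / r) powr (- h)) \<le> (1 + K) * r" using t(2) by linarith
    then have "c * (r powr h * ln (1 / r) powr (- h)) * (r powr (- h) * ln (1 / r) powr h)
       \<le> (1 + K) * r * (r powr (- h) * ln (1 / r) powr h)"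
      by (intro mult_right_mono) auto
    moreover have "c * (r powr h * ln (1 / r) powr (- h)) * (r powr (- h) * ln (1 / r) powr h) = c"
      using r L by (simp add: powr_minus field_simps)
    moreover have "(1 + K) * r * (r powr (- h) * ln (1 / r) powr h) = (1 + K) * (r powr (1 - h) * ln (1 / r) powr h)"
      using r by (simp add: powr_diff powr_minus field_simps)
    ultimately have "c \<le> (1 + K) * (r powr (1 - h) * ln (1 / r) powr h)" by linarith
    then have "c / (1 + K) \<le> r powr (1 - h) * ln (1 / r) powr h"
      using K(1) by (simp add: pos_divide_le_eq mult.commute)
    then show ?case using elim by linarith
  qed
  then show False by simp
qed

section \<open>Passage from one component to the vector-valued sheet\<close>

theorem theorem4p5:
  fixes M :: "'w measure"
    and B :: "real ^ 'n::{finite,linorder} \<Rightarrow> 'w \<Rightarrow> real ^ 'd"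
    and H :: "real ^ 'n::{finite,linorder}"
    and H1 :: real
    and I :: "(real ^ 'n::{finite,linorder}) set"
  assumes "prob_space M"
    and "\<forall>j. 0 < H $ j \<and> H $ j < 1"
    and "mono (\<lambda>j. H $ j)"
    and "H1 = H $ (Min UNIV)"
    and "fractional_brownian_sheet M H B"
    and "I \<in> pos_intervals"
  shows "(\<exists>c::real. 0 < c \<and>
      (\<forall>s\<in>I. AE \<omega> in M.
         ereal c \<le> Liminf (at_right 0) (\<lambda>r::real.
           SUP t \<in> ball s r \<inter> nonneg_orthant.
             ereal (norm (B t \<omega> - B s \<omega>) / (r powr H1 * ln (ln (1 / r)) powr (- H1))))) \<and>
      (AE \<omega> in M.
         ereal c \<le> Liminf (at_right 0) (\<lambda>r::real.
           INF s \<in> I. SUP t \<in> ball s r \<inter> nonneg_orthant.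
             ereal (norm (B t \<omega> - B s \<omega>) / (r powr H1 * ln (1 / r) powr (- H1)))))) \<and>
    (AE \<omega> in M. \<forall>s\<in>pos_orthant. \<not> (\<lambda>t. B t \<omega>) differentiable (at s))"
proof
  interpret prob_space M by fact
  define i where "i = (Min UNIV :: 'n)"
  have H1: "H1 = H $ i" using assms(4) by (simp add: i_def)
  have H: "0 < H $ l" "H $ l < 1" for l using assms(2) by auto
  \<comment> \<open>\<open>undefined\<close> stands for an arbitrary component index.\<close>
  define X where "X t \<omega> = B t \<omega> $ undefined" for t \<omega>
  have X: "real_fbs M H X"
    using assms(5) unfolding fractional_brownian_sheet_def X_def by blast
  have XB: "\<bar>X t \<omega> - X s \<omega>\<bar> \<le> norm (B t \<omega> - B s \<omega>)" for s t \<omega>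
    using component_le_norm_cart[of "B t \<omega> - B s \<omega>" undefined] by (simp add: X_def)
  \<comment> \<open>The gauge is positive because \<open>L\<close> and \<open>r\<close> are, which
    justifies the division; the positivity conjuncts in the lower bounds are there for this.\<close>
  have ratio: "c \<le> norm (B t \<omega> - B s \<omega>) / (r powr H1 * L powr (- H1))"
    if "c * (r powr H1 * L powr (- H1)) \<le> \<bar>X t \<omega> - X s \<omega>\<bar>" "0 < L" "0 < r" for c r L t s \<omega>
    using that XB[of t \<omega> s] by (subst pos_le_divide_eq) auto
  \<comment> \<open>Proved for an arbitrary interval, since it serves both the given
    \<open>I\<close> and every member of the countable cover.\<close>
  have uniform: "\<exists>c>0. AE \<omega> in M. \<forall>\<^sub>F r in at_right 0. 0 < ln (1 / r) \<and> (\<forall>s\<in>I. \<exists>t\<in>ball s r \<inter> nonneg_orthant.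
      c * (r powr H1 * ln (1 / r) powr (- H1)) \<le> \<bar>X t \<omega> - X s \<omega>\<bar>)"
    if "I \<in> pos_intervals" for I
  proof -
    obtain \<kappa> where \<kappa>: "0 < \<kappa>" and small: "\<And>s \<delta> m. s \<in> I \<Longrightarrow> 0 < \<delta> \<Longrightarrow>
      prob {\<omega>\<in>space M. \<forall>k\<in>{1..m}. \<bar>X (s + (of_nat k * \<delta>) *\<^sub>R axis i 1) \<omega> - X s \<omega>\<bar> \<le> \<kappa> * \<delta> powr (H $ i)}
      \<le> exp (- (of_nat m / 2))"
      using fbs_small_ball_uniform[OF X \<open>I \<in> pos_intervals\<close> H(1) H(2)[of i]] by blast
    show ?thesis
    proof (intro exI conjI)
      show "0 < \<kappa> / 2 * (1 / (2 * exp 1 * real (2 * CARD('n) + 3))) powr H1"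
        using \<kappa> by simp
    qed (rule fbs_uniform_lower_bound[OF X H(1) \<open>I \<in> pos_intervals\<close> \<kappa> small, folded H1])
  qed
  have local: "\<exists>c>0. \<forall>s\<in>I. AE \<omega> in M. \<forall>\<^sub>F r in at_right 0. 0 < ln (ln (1 / r)) \<and> (\<exists>t\<in>ball s r \<inter> nonneg_orthant.
      c * (r powr H1 * ln (ln (1 / r)) powr (- H1)) \<le> \<bar>X t \<omega> - X s \<omega>\<bar>)"
  proof -
    obtain \<kappa> where \<kappa>: "0 < \<kappa>" and small: "\<And>s \<delta> m. s \<in> I \<Longrightarrow> 0 < \<delta> \<Longrightarrow>
      prob {\<omega>\<in>space M. \<forall>k\<in>{1..m}. \<bar>X (s + (of_nat k * \<delta>) *\<^sub>R axis i 1) \<omega> - X s \<omega>\<bar> \<le> \<kappa> * \<delta> powr (H $ i)}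
      \<le> exp (- (of_nat m / 2))"
      using fbs_small_ball_uniform[OF X assms(6) H(1) H(2)[of i]] by blast
    have "I \<subseteq> pos_orthant" using assms(6) by (auto simp: pos_intervals_def)
    show ?thesis
    proof (intro exI conjI ballI)
      show "0 < \<kappa> * (1 / (2 * exp 1 * 6)) powr H1"
        using \<kappa> by simp
      fix s assume "s \<in> I"
      with \<open>I \<subseteq> pos_orthant\<close> have "s \<in> pos_orthant" by blast
      then show "AE \<omega> in M. \<forall>\<^sub>F r in at_right 0. 0 < ln (ln (1 / r)) \<and> (\<exists>t\<in>ball s r \<inter> nonneg_orthant.
          \<kappa> * (1 / (2 * exp 1 * 6)) powr H1 * (r powr H1 * ln (ln (1 / r)) powr (- H1)) \<le> \<bar>X t \<omega> - X s \<omega>\<bar>)"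
        by (rule fbs_local_lower_bound[OF X H(1) _ \<kappa> small[OF \<open>s \<in> I\<close>], folded H1])
    qed
  qed
  show "\<exists>c::real. 0 < c \<and>
      (\<forall>s\<in>I. AE \<omega> in M.
         ereal c \<le> Liminf (at_right 0) (\<lambda>r::real.
           SUP t \<in> ball s r \<inter> nonneg_orthant.
             ereal (norm (B t \<omega> - B s \<omega>) / (r powr H1 * ln (ln (1 / r)) powr (- H1))))) \<and>
      (AE \<omega> in M.
         ereal c \<le> Liminf (at_right 0) (\<lambda>r::real.
           INF s \<in> I. SUP t \<in> ball s r \<inter> nonneg_orthant.
             ereal (norm (B t \<omega> - B s \<omega>) / (r powr H1 * ln (1 / r) powr (- H1)))))"
  proof -
    obtain c1 where c1: "0 < c1" "\<And>s. s \<in> I \<Longrightarrow> AE \<omega> in M. \<forall>\<^sub>F r in at_right 0. 0 < ln (ln (1 / r)) \<and> (\<exists>t\<in>ball s r \<inter> nonneg_orthant.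
        c1 * (r powr H1 * ln (ln (1 / r)) powr (- H1)) \<le> \<bar>X t \<omega> - X s \<omega>\<bar>)"
      using local by blast
    obtain c2 where c2: "0 < c2" "AE \<omega> in M. \<forall>\<^sub>F r in at_right 0. 0 < ln (1 / r) \<and> (\<forall>s\<in>I. \<exists>t\<in>ball s r \<inter> nonneg_orthant.
        c2 * (r powr H1 * ln (1 / r) powr (- H1)) \<le> \<bar>X t \<omega> - X s \<omega>\<bar>)"
      using uniform[OF assms(6)] by blast
    have pos: "\<forall>\<^sub>F r in at_right (0::real). 0 < r"
      by (auto simp: eventually_at_right_field intro: exI[of _ 1])
    show ?thesis
    proof (intro exI[of _ "min c1 c2"] conjI ballI)
      show "0 < min c1 c2" using c1(1) c2(1) by simp
    next
      fix s assume "s \<in> I"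
      from c1(2)[OF this] show "AE \<omega> in M. ereal (min c1 c2) \<le> Liminf (at_right 0) (\<lambda>r::real.
           SUP t \<in> ball s r \<inter> nonneg_orthant.
             ereal (norm (B t \<omega> - B s \<omega>) / (r powr H1 * ln (ln (1 / r)) powr (- H1))))"
      proof eventually_elim
        case (elim \<omega>)
        show ?case
          by (rule Liminf_bounded, use elim pos in eventually_elim)
             (auto intro!: SUP_upper2 order_trans[OF min.cobounded1] ratio)
      qed
    next
      from c2(2) show "AE \<omega> in M. ereal (min c1 c2) \<le> Liminf (at_right 0) (\<lambda>r::real.
           INF s \<in> I. SUP t \<in> ball s r \<inter> nonneg_orthant.
             ereal (norm (B t \<omega> - B s \<omega>) / (r powr H1 * ln (1 / r) powr (- H1))))"
      proof eventually_elim
        case (elim \<omega>)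
        show ?case
        proof (rule Liminf_bounded, use elim pos in eventually_elim)
          fix r :: real
          assume r: "0 < ln (1 / r) \<and> (\<forall>s\<in>I. \<exists>t\<in>ball s r \<inter> nonneg_orthant.
            c2 * (r powr H1 * ln (1 / r) powr (- H1)) \<le> \<bar>X t \<omega> - X s \<omega>\<bar>)" "0 < r"
          show "ereal (min c1 c2) \<le> (INF s \<in> I. SUP t \<in> ball s r \<inter> nonneg_orthant.
             ereal (norm (B t \<omega> - B s \<omega>) / (r powr H1 * ln (1 / r) powr (- H1))))"
          proof (rule INF_greatest)
            fix s assume "s \<in> I"
            then obtain t where t: "t \<in> ball s r \<inter> nonneg_orthant"
              "c2 * (r powr H1 * ln (1 / r) powr (- H1)) \<le> \<bar>X t \<omega> - X s \<omega>\<bar>" using r(1) by blast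
            show "ereal (min c1 c2) \<le> (SUP t \<in> ball s r \<inter> nonneg_orthant.
               ereal (norm (B t \<omega> - B s \<omega>) / (r powr H1 * ln (1 / r) powr (- H1))))"
              using ratio[OF t(2) _ r(2)] r(1) by (intro SUP_upper2[OF t(1)]) (auto simp: min_le_iff_disj)
          qed
        qed
      qed
    qed
  qed
  obtain J :: "nat \<Rightarrow> (real ^ 'n::{finite,linorder}) set" where J: "range J \<subseteq> pos_intervals" "pos_orthant \<subseteq> (\<Union>k. J k)"
    using pos_orthant_countable_cover by blast
  have "AE \<omega> in M. \<forall>k. \<forall>s\<in>J k. \<not> (\<lambda>t. B t \<omega>) differentiable (at s)"
    unfolding AE_all_countable
  proof
    fix k
    have "J k \<in> pos_intervals" using J(1) by blast
    from uniform[OF this] obtain c where "0 < c" "AE \<omega> in M. \<forall>\<^sub>F r in at_right 0. 0 < ln (1 / r) \<and> (\<forall>s\<in>J k. \<exists>t\<in>ball s r \<inter> nonneg_orthant.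
        c * (r powr H1 * ln (1 / r) powr (- H1)) \<le> \<bar>X t \<omega> - X s \<omega>\<bar>)"
      by blast
    from this(2) show "AE \<omega> in M. \<forall>s\<in>J k. \<not> (\<lambda>t. B t \<omega>) differentiable (at s)"
    proof eventually_elim
      case (elim \<omega>)
      show ?case
      proof
        fix s assume s: "s \<in> J k"
        have "\<forall>\<^sub>F r in at_right 0. \<exists>t\<in>ball s r. c * (r powr H1 * ln (1 / r) powr (- H1)) \<le> norm (B t \<omega> - B s \<omega>)"
          using elim by eventually_elim (use s XB in \<open>meson IntD1 order_trans\<close>)
        then show "\<not> (\<lambda>t. B t \<omega>) differentiable (at s)"
          using H \<open>0 < c\<close> unfolding H1 by (intro not_differentiable_if_rough) auto
      qed
    qed
  qed
  then show "AE \<omega> in M. \<forall>s\<in>pos_orthant. \<not> (\<lambda>t. B t \<omega>) differentiable (at s)"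
    by eventually_elim (use J(2) in blast)
qed

end
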